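(* Let $(\mathcal K=K_{-1}\oplus K_0,\partial,\rho,\mathcal S,\diamond,\Omega)$ be an $E$-$\mathrm{LWX}$ $2$-algebroid over $M$. Put $\mathfrak e_{-2}=\Gamma(E)$, $\mathfrak e_{-1}=\Gamma(K_{-1})$, $\mathfrak e_0=\Gamma(K_0)$ and $[\![e_1,e_2]\!]=\frac12(e_1\diamond e_2-e_2\diamond e_1)$. Then $(\mathfrak e,\mathfrak l_1,\mathfrak l_2,\mathfrak l_3,\mathfrak l_4)$ is a Lie $3$-algebra, where $\mathfrak l_1(u)=\mathcal D(u)$ for $u\in\Gamma(E)$; $\mathfrak l_1(e^1)=\partial(e^1)$ for $e^1\in\Gamma(K_{-1})$; $\mathfrak l_2(e^0_1,e^0_2)=[\![e^0_1,e^0_2]\!]$; $\mathfrak l_2(e^0,e^1)=[\![e^0,e^1]\!]$; $\mathfrak l_2(e^0,f)=\frac12\mathcal S(e^0,\mathcal Df)$ for $f\in\Gamma(E)$; $\mathfrak l_2(e^1_1,e^1_2)=0$; $\mathfrak l_3(e^0_1,e^0_2,e^0_3)=\Omega(e^0_1,e^0_2,e^0_3)$; $\mathfrak l_3(e^0_1,e^0_2,e^1)=-T(e^0_1,e^0_2,e^1)$; $\mathfrak l_4(e^0_1,e^0_2,e^0_3,e^0_4)=\mathcal S(\Omega(e^0_1,e^0_2,e^0_3),e^0_4)$, with $T(e^0_1,e^0_2,e^1)=\frac16\big(\mathcal S(e^0_1,[\![e^0_2,e^1]\!])+\mathcal S(e^1,[\![e^0_1,e^0_2]\!])+\mathcal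 S(e^0_2,[\![e^1,e^0_1]\!])\big)$ (here $e^0,e^0_i\in\Gamma(K_0)$, $e^1\in\Gamma(K_{-1})$, and all brackets not listed or determined by graded skew-symmetry vanish).
   Context: For a vector bundle $E\to M$, $\mathfrak D E$ is the bundle of first-order covariant differential operators on $E$ (with commutator bracket $[\cdot,\cdot]_{\mathfrak D}$) and $\mathfrak J E$ the first jet bundle; $\langle\mu,\mathfrak d\rangle_E=\mathfrak d(u)$ for $\mu=[u]_m\in(\mathfrak JE)_m$, $\mathfrak d\in(\mathfrak DE)_m$. $E$-$\mathrm{LWX}$ $2$-algebroid: a graded vector bundle $\mathcal K=K_{-1}\oplus K_0$ over $M$ with a bundle map $\partial:K_{-1}\to K_0$; a surjective nondegenerate graded symmetric $E$-valued pairing $\mathcal S:\mathcal K\otimes\mathcal K\to E$ of degree $1$ (pairing $K_0$ with $K_{-1}$) inducing an embedding $\mathcal K\hookrightarrow\mathrm{Hom}(\mathcal K,E)$; a bundle map $\rho:K_0\to\mathfrak DE$ with $\rho^*(\mathfrak JE)\subset K_{-1}$, i.e. $\mathcal S(\rho^*(\mu),e^0)=\langle\mu,\rho(e^0)\rangle_E$; an $\mathbb R$-bilinear operation $\diamond:\Gamma(K_{-i})\times\Gamma(K_{-j})\to\Gamma(K_{-(i+j)})$, $0\le i+j\le1$; and a bundle map $\Omega:\wedge^3K_0\to K_{-1}$; such that (E1) $(\Gamma(\mathcal K),\partial,\diamond,\Omega)$ is a Leibniz $2$-algebra (a $2$-term $Lod_\infty$-algebra with $l_1=\partial$, $l_2=\diamond$,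 $l_3=\Omega$); (E2) $e\diamond e=\frac12\mathcal D\mathcal S(e,e)$, where $\mathcal D:\Gamma(E)\to\Gamma(K_{-1})$ is defined by $\mathcal S(\mathcal Du,e^0)=\rho(e^0)(u)$; (E3) $\mathcal S(\partial e^1_1,e^1_2)=\mathcal S(e^1_1,\partial e^1_2)$; (E4) $\rho(e_1)\mathcal S(e_2,e_3)=\mathcal S(e_1\diamond e_2,e_3)+\mathcal S(e_2,e_1\diamond e_3)$; (E5) $\mathcal S(\Omega(e^0_1,e^0_2,e^0_3),e^0_4)=-\mathcal S(e^0_3,\Omega(e^0_1,e^0_2,e^0_4))$; (E6) $\rho(e^0_1\diamond e^0_2)=[\rho(e^0_1),\rho(e^0_2)]_{\mathfrak D}$. Lie $3$-algebra: a graded vector space $\mathfrak e=\mathfrak e_{-2}\oplus\mathfrak e_{-1}\oplus\mathfrak e_0$ with graded skew-symmetric multilinear brackets $\mathfrak l_i$ of degree $2-i$, $1\le i\le4$, satisfying the $L_\infty$-algebra identities $\sum_{i+j=k+1}(-1)^{i(j-1)}\sum_{\sigma\in Sh^{-1}_{i,k-i}}\mathrm{sgn}(\sigma)\epsilon(\sigma)\mathfrak l_j(\mathfrak l_i(x_{\sigma(1)},\dots,x_{\sigma(i)}),x_{\sigma(i+1)},\dots,x_{\sigma(k)})=0$. *)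

theory Defs
  imports "HOL-Analysis.Analysis"
begin

text \<open>The underlying graded vector space e = e_{-2} + e_{-1} + e_0 is modelled as the product
 'a * 'b * 'c (components of degree -2, -1, 0). An element x is homogeneous of degree d
 when only its degree-d component can be nonzero (for d outside {-2,-1,0}: x = 0).\<close>

definition hom_deg :: "int \<Rightarrow> ('a::zero \<times> 'b::zero \<times> 'c::zero) \<Rightarrow> bool" where
  "hom_deg d x \<longleftrightarrow> (case x of (u, a, e) \<Rightarrow>
     (if d = -2 then a = 0 \<and> e = 0
      else if d = -1 then u = 0 \<and> e = 0
      else if d = 0 then u = 0 \<and> a = 0
      else u = 0 \<and> a = 0 \<and> e = 0))"

definition perm_list :: "(nat \<Rightarrow> nat) \<Rightarrow> 'x list \<Rightarrow> 'x list" where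
  "perm_list s xs = map (\<lambda>i. xs ! s i) [0..<length xs]"

definition koszul_sign :: "(nat \<Rightarrow> nat) \<Rightarrow> int list \<Rightarrow> real" where
  "koszul_sign s ds =
     (\<Prod>p \<in> {(a, b). a < b \<and> b < length ds \<and> s b < s a}.
        if even (ds ! s (fst p) * ds ! s (snd p)) then 1 else -1)"

definition chi_sign :: "(nat \<Rightarrow> nat) \<Rightarrow> int list \<Rightarrow> real" where
  "chi_sign s ds = real_of_int (sign s) * koszul_sign s ds"

definition unshuffles :: "nat \<Rightarrow> nat \<Rightarrow> (nat \<Rightarrow> nat) set" where
  "unshuffles i k = {s. s permutes {..<k}
      \<and> (\<forall>a b. a < b \<and> b < i \<longrightarrow> s a < s b)
      \<and> (\<forall>a b. i \<le> a \<and> a < b \<and> b < k \<longrightarrow> s a < s b)}"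

definition homogeneous_list :: "int list \<Rightarrow> ('a::zero \<times> 'b::zero \<times> 'c::zero) list \<Rightarrow> bool" where
  "homogeneous_list ds xs \<longleftrightarrow> length ds = length xs \<and> (\<forall>i < length xs. hom_deg (ds ! i) (xs ! i))"

text \<open>A Lie 3-algebra structure: brackets l n (n = 1..4) of n arguments, given as functions of
 argument lists of length n; l n is zero for n = 0 and n > 4 (these brackets do not exist).
 The brackets are multilinear, graded skew-symmetric, of degree 2 - n, and satisfy the
 L-infinity identities.\<close>
definition lie3_algebra ::
  "(nat \<Rightarrow> ('a::real_vector \<times> 'b::real_vector \<times> 'c::real_vector) list \<Rightarrow> ('a \<times> 'b \<times> 'c)) \<Rightarrow> bool" where
  "lie3_algebra l \<longleftrightarrow>
     (\<forall>n xs. (n = 0 \<or> 4 < n) \<longrightarrow> l n xs = 0)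
   \<and> (\<forall>n \<in> {1..4}. \<forall>xs p c x y. length xs = n \<and> p < n \<longrightarrow>
        l n (xs[p := c *\<^sub>R x + y]) = c *\<^sub>R l n (xs[p := x]) + l n (xs[p := y]))
   \<and> (\<forall>n \<in> {1..4}. \<forall>xs ds. length xs = n \<and> homogeneous_list ds xs \<longrightarrow>
        hom_deg (sum_list ds + 2 - int n) (l n xs))
   \<and> (\<forall>n \<in> {1..4}. \<forall>xs ds s. length xs = n \<and> homogeneous_list ds xs \<and> s permutes {..<n} \<longrightarrow>
        l n (perm_list s xs) = chi_sign s ds *\<^sub>R l n xs)
   \<and> (\<forall>k xs ds. 1 \<le> k \<and> length xs = k \<and> homogeneous_list ds xs \<longrightarrow>
        (\<Sum>i \<in> {1..k}. (-1::real) ^ (i * (k - i)) *\<^sub>R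
           (\<Sum>s \<in> unshuffles i k. chi_sign s ds *\<^sub>R
              l (k + 1 - i) (l i (take i (perm_list s xs)) # drop i (perm_list s xs)))) = 0)"

text \<open>'r plays the role of C^infinity(M); 'u, 'k1, 'k0 are Gamma(E), Gamma(K_{-1}), Gamma(K_0),
 which are 'r-modules (compatible with the real vector space structure).\<close>

definition is_module :: "('r::{comm_ring_1,real_algebra_1} \<Rightarrow> 'x::real_vector \<Rightarrow> 'x) \<Rightarrow> bool" where
  "is_module act \<longleftrightarrow>
     (\<forall>f x y. act f (x + y) = act f x + act f y)
   \<and> (\<forall>f g x. act (f + g) x = act f x + act g x)
   \<and> (\<forall>f g x. act (f * g) x = act f (act g x))
   \<and> (\<forall>x. act 1 x = x)
   \<and> (\<forall>c x. act (of_real c) x = c *\<^sub>R x)"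

definition is_derivation :: "('r::{comm_ring_1,real_algebra_1} \<Rightarrow> 'r) \<Rightarrow> bool" where
  "is_derivation X \<longleftrightarrow>
     (\<forall>f g. X (f + g) = X f + X g) \<and> (\<forall>c f. X (c *\<^sub>R f) = c *\<^sub>R X f)
   \<and> (\<forall>f g. X (f * g) = f * X g + g * X f)"

text \<open>Sections of DE: first-order covariant differential operators on E, i.e. real-linear
 operators d on Gamma(E) with a symbol X (a vector field) such that d(f u) = f d(u) + X(f) u.\<close>
definition is_cov_diff_op ::
  "('r::{comm_ring_1,real_algebra_1} \<Rightarrow> 'u::real_vector \<Rightarrow> 'u) \<Rightarrow> ('u \<Rightarrow> 'u) \<Rightarrow> bool" where
  "is_cov_diff_op actE d \<longleftrightarrow>
     (\<forall>u v. d (u + v) = d u + d v) \<and> (\<forall>c u. d (c *\<^sub>R u) = c *\<^sub>R d u)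
   \<and> (\<exists>X. is_derivation X \<and> (\<forall>f u. d (actE f u) = actE f (d u) + actE (X f) u))"

text \<open>Total operations on Gamma(K) = Gamma(K_{-1}) + Gamma(K_0), represented as pairs (e^1, e^0).
 The degree-1 graded symmetric pairing S is determined by its part pS : K_0 x K_{-1} -> E:
 S((a,x),(b,y)) = pS x b + pS y a.  The anchor is extended by zero on K_{-1}.\<close>

definition tot_S :: "('k0 \<Rightarrow> 'k1 \<Rightarrow> 'u::ab_group_add) \<Rightarrow> ('k1 \<times> 'k0) \<Rightarrow> ('k1 \<times> 'k0) \<Rightarrow> 'u" where
  "tot_S pS e1 e2 = pS (snd e1) (fst e2) + pS (snd e2) (fst e1)"

definition tot_dia ::
  "('k0 \<Rightarrow> 'k0 \<Rightarrow> 'k0) \<Rightarrow> ('k0 \<Rightarrow> 'k1 \<Rightarrow> 'k1::ab_group_add) \<Rightarrow> ('k1 \<Rightarrow> 'k0 \<Rightarrow> 'k1)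
    \<Rightarrow> ('k1 \<times> 'k0) \<Rightarrow> ('k1 \<times> 'k0) \<Rightarrow> ('k1 \<times> 'k0)" where
  "tot_dia d00 d01 d10 e1 e2 =
     (d01 (snd e1) (fst e2) + d10 (fst e1) (snd e2), d00 (snd e1) (snd e2))"

text \<open>Leibniz 2-algebra (2-term Lod-infinity algebra) V_1 --d--> V_0 with l_2 given by
 d00 : V0 x V0 -> V0, d01 : V0 x V1 -> V1, d10 : V1 x V0 -> V1 and l_3 = Om : V0^3 -> V1
 (Sheng-Liu).\<close>
definition leibniz_2_algebra ::
  "('k1::real_vector \<Rightarrow> 'k0::real_vector) \<Rightarrow> ('k0 \<Rightarrow> 'k0 \<Rightarrow> 'k0) \<Rightarrow> ('k0 \<Rightarrow> 'k1 \<Rightarrow> 'k1)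
    \<Rightarrow> ('k1 \<Rightarrow> 'k0 \<Rightarrow> 'k1) \<Rightarrow> ('k0 \<Rightarrow> 'k0 \<Rightarrow> 'k0 \<Rightarrow> 'k1) \<Rightarrow> bool" where
  "leibniz_2_algebra d d00 d01 d10 Om \<longleftrightarrow>
     linear d
   \<and> (\<forall>x. linear (d00 x)) \<and> (\<forall>y. linear (\<lambda>x. d00 x y))
   \<and> (\<forall>x. linear (d01 x)) \<and> (\<forall>m. linear (\<lambda>x. d01 x m))
   \<and> (\<forall>m. linear (d10 m)) \<and> (\<forall>x. linear (\<lambda>m. d10 m x))
   \<and> (\<forall>x y. linear (Om x y)) \<and> (\<forall>x z. linear (\<lambda>y. Om x y z)) \<and> (\<forall>y z. linear (\<lambda>x. Om x y z))
   \<and> (\<forall>m n. d01 (d m) n = d10 m (d n))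
   \<and> (\<forall>x m. d (d01 x m) = d00 x (d m))
   \<and> (\<forall>x m. d (d10 m x) = d00 (d m) x)
   \<and> (\<forall>x y z. d (Om x y z) = d00 x (d00 y z) - d00 (d00 x y) z - d00 y (d00 x z))
   \<and> (\<forall>x y m. Om x y (d m) = d01 x (d01 y m) - d01 (d00 x y) m - d01 y (d01 x m))
   \<and> (\<forall>x y m. Om x (d m) y = d01 x (d10 m y) - d10 (d01 x m) y - d10 m (d00 x y))
   \<and> (\<forall>x y m. Om (d m) x y = d10 m (d00 x y) - d10 (d10 m x) y - d01 x (d10 m y))
   \<and> (\<forall>w x y z.
        d01 w (Om x y z) - d01 x (Om w y z) + d01 y (Om w x z) + d10 (Om w x y) z
      - Om (d00 w x) y z - Om x (d00 w y) z - Om x y (d00 w z)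
      + Om w (d00 x y) z + Om w y (d00 x z) - Om w x (d00 y z) = 0)"

definition E_LWX_2_algebroid ::
  "('r::{comm_ring_1,real_algebra_1} \<Rightarrow> 'u::real_vector \<Rightarrow> 'u)
   \<Rightarrow> ('r \<Rightarrow> 'k1::real_vector \<Rightarrow> 'k1) \<Rightarrow> ('r \<Rightarrow> 'k0::real_vector \<Rightarrow> 'k0)
   \<Rightarrow> ('k1 \<Rightarrow> 'k0) \<Rightarrow> ('k0 \<Rightarrow> 'u \<Rightarrow> 'u) \<Rightarrow> ('k0 \<Rightarrow> 'k1 \<Rightarrow> 'u)
   \<Rightarrow> ('k0 \<Rightarrow> 'k0 \<Rightarrow> 'k0) \<Rightarrow> ('k0 \<Rightarrow> 'k1 \<Rightarrow> 'k1) \<Rightarrow> ('k1 \<Rightarrow> 'k0 \<Rightarrow> 'k1)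
   \<Rightarrow> ('k0 \<Rightarrow> 'k0 \<Rightarrow> 'k0 \<Rightarrow> 'k1) \<Rightarrow> ('u \<Rightarrow> 'k1) \<Rightarrow> bool" where
  "E_LWX_2_algebroid actE act1 act0 pd rho pS d00 d01 d10 Om D \<longleftrightarrow>
     is_module actE \<and> is_module act1 \<and> is_module act0
     \<comment> \<open>partial is a bundle map\<close>
   \<and> (\<forall>a b. pd (a + b) = pd a + pd b) \<and> (\<forall>f a. pd (act1 f a) = act0 f (pd a))
     \<comment> \<open>S is C-infinity-bilinear, nondegenerate and surjective\<close>
   \<and> (\<forall>x y b. pS (x + y) b = pS x b + pS y b) \<and> (\<forall>x a b. pS x (a + b) = pS x a + pS x b)
   \<and> (\<forall>f x b. pS (act0 f x) b = actE f (pS x b)) \<and> (\<forall>f x b. pS x (act1 f b) = actE f (pS x b))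
   \<and> (\<forall>x. (\<forall>b. pS x b = 0) \<longrightarrow> x = 0) \<and> (\<forall>b. (\<forall>x. pS x b = 0) \<longrightarrow> b = 0)
   \<and> (\<forall>u. \<exists>ps. u = sum_list (map (\<lambda>p. pS (fst p) (snd p)) ps))
     \<comment> \<open>rho is a bundle map K_0 -> DE\<close>
   \<and> (\<forall>x y u. rho (x + y) u = rho x u + rho y u) \<and> (\<forall>f x u. rho (act0 f x) u = actE f (rho x u))
   \<and> (\<forall>x. is_cov_diff_op actE (rho x))
     \<comment> \<open>D: S(D u, e^0) = rho(e^0)(u); its existence is the condition rho^*(JE) in K_{-1}\<close>
   \<and> (\<forall>u x. pS x (D u) = rho x u)
     \<comment> \<open>Omega is a bundle map wedge^3 K_0 -> K_{-1}\<close>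
   \<and> (\<forall>x x' y z. Om (x + x') y z = Om x y z + Om x' y z)
   \<and> (\<forall>f x y z. Om (act0 f x) y z = act1 f (Om x y z))
   \<and> (\<forall>x y z. Om x y z = - Om y x z) \<and> (\<forall>x y z. Om x y z = - Om x z y)
     \<comment> \<open>(E1)\<close>
   \<and> leibniz_2_algebra pd d00 d01 d10 Om
     \<comment> \<open>(E2)\<close>
   \<and> (\<forall>e. tot_dia d00 d01 d10 e e = (1/2) *\<^sub>R (D (tot_S pS e e), 0))
     \<comment> \<open>(E3)\<close>
   \<and> (\<forall>a b. pS (pd a) b = pS (pd b) a)
     \<comment> \<open>(E4)\<close>
   \<and> (\<forall>e1 e2 e3. rho (snd e1) (tot_S pS e2 e3)
        = tot_S pS (tot_dia d00 d01 d10 e1 e2) e3 + tot_S pS e2 (tot_dia d00 d01 d10 e1 e3))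
     \<comment> \<open>(E5)\<close>
   \<and> (\<forall>x1 x2 x3 x4. pS x4 (Om x1 x2 x3) = - pS x3 (Om x1 x2 x4))
     \<comment> \<open>(E6)\<close>
   \<and> (\<forall>x y. rho (d00 x y) = (\<lambda>u. rho x (rho y u) - rho y (rho x u)))"

definition skew00 :: "('k0 \<Rightarrow> 'k0 \<Rightarrow> 'k0::real_vector) \<Rightarrow> 'k0 \<Rightarrow> 'k0 \<Rightarrow> 'k0" where
  "skew00 d00 x y = (1/2) *\<^sub>R (d00 x y - d00 y x)"

definition skew01 :: "('k0 \<Rightarrow> 'k1 \<Rightarrow> 'k1::real_vector) \<Rightarrow> ('k1 \<Rightarrow> 'k0 \<Rightarrow> 'k1) \<Rightarrow> 'k0 \<Rightarrow> 'k1 \<Rightarrow> 'k1" where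
  "skew01 d01 d10 x b = (1/2) *\<^sub>R (d01 x b - d10 b x)"

definition T_op ::
  "('k0 \<Rightarrow> 'k1 \<Rightarrow> 'u::real_vector) \<Rightarrow> ('k0 \<Rightarrow> 'k0 \<Rightarrow> 'k0::real_vector) \<Rightarrow> ('k0 \<Rightarrow> 'k1 \<Rightarrow> 'k1::real_vector)
    \<Rightarrow> ('k1 \<Rightarrow> 'k0 \<Rightarrow> 'k1) \<Rightarrow> 'k0 \<Rightarrow> 'k0 \<Rightarrow> 'k1 \<Rightarrow> 'u" where
  "T_op pS d00 d01 d10 x y b = (1/6) *\<^sub>R
     (pS x (skew01 d01 d10 y b) + pS (skew00 d00 x y) b + pS y (- skew01 d01 d10 x b))"

text \<open>The brackets l_n on e = Gamma(E) x Gamma(K_{-1}) x Gamma(K_0), written as the multilinear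
 extensions of the table in the theorem (all other homogeneous brackets being determined by graded
 skew-symmetry or zero).  Arguments x = (u, a, e) with u in Gamma(E), a in Gamma(K_{-1}),
 e in Gamma(K_0).\<close>
definition lwx_bracket ::
  "('k1 \<Rightarrow> 'k0) \<Rightarrow> ('k0 \<Rightarrow> 'k1 \<Rightarrow> 'u::real_vector)
   \<Rightarrow> ('k0 \<Rightarrow> 'k0 \<Rightarrow> 'k0::real_vector) \<Rightarrow> ('k0 \<Rightarrow> 'k1 \<Rightarrow> 'k1::real_vector) \<Rightarrow> ('k1 \<Rightarrow> 'k0 \<Rightarrow> 'k1)
   \<Rightarrow> ('k0 \<Rightarrow> 'k0 \<Rightarrow> 'k0 \<Rightarrow> 'k1) \<Rightarrow> ('u \<Rightarrow> 'k1)
   \<Rightarrow> nat \<Rightarrow> ('u \<times> 'k1 \<times> 'k0) list \<Rightarrow> ('u \<times> 'k1 \<times> 'k0)" where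
  "lwx_bracket pd pS d00 d01 d10 Om D n xs =
    (let U = (\<lambda>i. fst (xs ! i)); A = (\<lambda>i. fst (snd (xs ! i))); E = (\<lambda>i. snd (snd (xs ! i)));
         T = T_op pS d00 d01 d10 in
     if n = 1 \<and> length xs = 1 then (0, D (U 0), pd (A 0))
     else if n = 2 \<and> length xs = 2 then
       ((1/2) *\<^sub>R pS (E 0) (D (U 1)) - (1/2) *\<^sub>R pS (E 1) (D (U 0)),
        skew01 d01 d10 (E 0) (A 1) - skew01 d01 d10 (E 1) (A 0),
        skew00 d00 (E 0) (E 1))
     else if n = 3 \<and> length xs = 3 then
       (- T (E 0) (E 1) (A 2) + T (E 0) (E 2) (A 1) - T (E 1) (E 2) (A 0),
        Om (E 0) (E 1) (E 2), 0)
     else if n = 4 \<and> length xs = 4 then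
       (pS (E 3) (Om (E 0) (E 1) (E 2)), 0, 0)
     else 0)"

end

theory Submission
  imports Defs
begin

text \<open>Nondegeneracy and surjectivity of the pairing turn the axioms into a calculus in which the
 bracket on \<open>K\<^sub>0\<close> is already skew, \<open>e\<^sup>1 \<diamond> e\<^sup>0 = D S(e\<^sup>0, e\<^sup>1) - e\<^sup>0 \<diamond> e\<^sup>1\<close>, \<open>\<partial> \<circ> D = 0\<close> and
 \<open>e\<^sup>0 \<diamond> D u = D (\<rho>(e\<^sup>0) u)\<close>; in particular \<open>4 T(x, y, a) = S(x, y \<diamond> a) - S(y, x \<diamond> a)\<close>.
 By degree reasons the \<open>k\<close>-th L-infinity identity is nontrivial only for \<open>k \<le> 5\<close>.  For \<open>k = 3\<close> and \<open>k = 4\<close>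
 the failure of \<open>\<diamond>\<close> to be skew is compensated by \<open>T\<close> and \<open>l\<^sub>4\<close>, and for \<open>k = 5\<close> the identity
 is a multiple of the closedness of the 4-form \<open>\<Phi>(w, x, y, z) = S(\<Omega>(w, x, y), z)\<close>, which is the
 pairing with a fifth section of the Leibniz 2-algebra identity for \<open>\<Omega>\<close>.\<close>

section \<open>Unshuffles and signs as words\<close>

definition pairs_below :: "nat \<Rightarrow> (nat \<times> nat) set" where
  "pairs_below n = {(a, b). a < b \<and> b < n}"

lemma finite_pairs_below [simp]: "finite (pairs_below n)"
  by (rule finite_subset[of _ "{..<n} \<times> {..<n}"]) (auto simp: pairs_below_def)

definition inv_factor :: "(nat \<Rightarrow> nat) \<Rightarrow> nat \<times> nat \<Rightarrow> int" where
  "inv_factor s p = (if s (snd p) < s (fst p) then -1 else 1)"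

text \<open>A pair is inverted by \<open>s \<circ> t\<close> when exactly one of two things happens:
  \<open>t\<close> inverts it, or \<open>s\<close> inverts its sorted image under \<open>t\<close>.
  Sorting the image is a bijection \<open>\<phi>\<close> of the pairs, so the factor for
  \<open>s\<close> can be reindexed.\<close>

lemma prod_inv_factor_comp:
  assumes s: "s permutes {..<n}" and t: "t permutes {..<n}"
  shows "prod (inv_factor (s \<circ> t)) (pairs_below n)
       = prod (inv_factor s) (pairs_below n) * prod (inv_factor t) (pairs_below n)"
proof -
  define \<phi> where "\<phi> = (\<lambda>(a, b). (min (t a) (t b), max (t a) (t b)))"
  have t_inj: "t a = t b \<longleftrightarrow> a = b" and s_inj: "s a = s b \<longleftrightarrow> a = b" for a b
    using permutes_inj[OF t] permutes_inj[OF s] by (auto dest: injD)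
  have t_lt: "t a < n \<longleftrightarrow> a < n" for a
    using permutes_in_image[OF t, of a] by simp
  have maps: "\<phi> ` pairs_below n \<subseteq> pairs_below n"
  proof
    fix q assume "q \<in> \<phi> ` pairs_below n"
    then obtain a b where q: "q = \<phi> (a, b)" "a < b" "b < n" by (auto simp: pairs_below_def)
    then have "t a \<noteq> t b" "t a < n" "t b < n" by (auto simp: t_inj t_lt)
    then show "q \<in> pairs_below n" by (auto simp: q(1) pairs_below_def \<phi>_def)
  qed
  have "inj_on \<phi> (pairs_below n)"
    by (auto simp: inj_on_def pairs_below_def \<phi>_def min_def max_def t_inj split: if_splits)
  with maps have bij: "bij_betw \<phi> (pairs_below n) (pairs_below n)"
    by (simp add: bij_betw_def endo_inj_surj)
  have "inv_factor (s \<circ> t) p = inv_factor s (\<phi> p) * inv_factor t p" if p_in: "p \<in> pairs_below n" for p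
  proof -
    obtain a b where p: "p = (a, b)" "a < b" using p_in by (auto simp: pairs_below_def)
    have "t a \<noteq> t b" "s (t a) \<noteq> s (t b)" using p by (auto simp: t_inj s_inj)
    then show ?thesis unfolding p inv_factor_def \<phi>_def by (auto simp: min_def max_def)
  qed
  then have "prod (inv_factor (s \<circ> t)) (pairs_below n)
      = (\<Prod>p\<in>pairs_below n. inv_factor s (\<phi> p)) * prod (inv_factor t) (pairs_below n)"
    by (simp add: prod.distrib)
  also have "(\<Prod>p\<in>pairs_below n. inv_factor s (\<phi> p)) = prod (inv_factor s) (pairs_below n)"
    by (rule prod.reindex_bij_betw[OF bij])
  finally show ?thesis .
qed

text \<open>The inversions of the transposition are the pairs \<open>(i, b)\<close> with
  \<open>i < b \<le> j\<close> and \<open>(a, j)\<close> with \<open>i < a < j\<close>; their number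
  \<open>2 * (j - i) - 1\<close> is odd.\<close>

lemma prod_inv_factor_transpose:
  assumes "i < j" "j < n"
  shows "prod (inv_factor (Transposition.transpose i j)) (pairs_below n) = -1"
proof -
  let ?A = "(\<lambda>b. (i, b)) ` {i<..j}" and ?B = "(\<lambda>a. (a, j)) ` {i<..<j}"
  have inv: "{p \<in> pairs_below n. Transposition.transpose i j (snd p) < Transposition.transpose i j (fst p)} = ?A \<union> ?B"
    using assms by (auto simp: pairs_below_def Transposition.transpose_def image_iff split: if_splits)
  have "?A \<inter> ?B = {}" by auto
  then have "card (?A \<union> ?B) = (j - i) + (j - i - 1)"
    by (simp add: card_Un_disjoint card_image inj_on_def)
  also have "\<dots> = Suc (2 * (j - i - 1))" using assms by simp
  finally have card: "card (?A \<union> ?B) = Suc (2 * (j - i - 1))" .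
  have "prod (inv_factor (Transposition.transpose i j)) (pairs_below n)
      = (\<Prod>p\<in>{p \<in> pairs_below n. Transposition.transpose i j (snd p) < Transposition.transpose i j (fst p)}. -1)"
    unfolding inv_factor_def by (rule prod.inter_filter[symmetric]) simp
  then show ?thesis unfolding inv by (simp only: prod_constant card) simp
qed

text \<open>Both sides are multiplicative and equal -1 on transpositions, which generate. The Koszul
  sign is a product over inversions as well, so in this form the two signs can be merged.\<close>

lemma sign_eq_prod_inversions:
  assumes "s permutes {..<n}"
  shows "sign s = prod (inv_factor s) (pairs_below n)"
  using assms finite_lessThan
proof (induction s rule: permutes_induct)
  case id
  have "inv_factor (\<lambda>a. a) p = 1" if "p \<in> pairs_below n" for p
    using that by (auto simp: inv_factor_def pairs_below_def)
  then show ?case by (simp add: id_def)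
next
  case (swap a b p)
  have tr: "prod (inv_factor (Transposition.transpose a b)) (pairs_below n) = -1"
    using swap.hyps prod_inv_factor_transpose[of a b n] prod_inv_factor_transpose[of b a n]
    by (cases a b rule: linorder_cases) (auto simp: transpose_commute)
  have perm: "Transposition.transpose a b permutes {..<n}" using swap.hyps by (intro permutes_swap_id)
  have "sign (Transposition.transpose a b \<circ> p) = sign (Transposition.transpose a b) * sign p"
    using swap.hyps permutation_permutes by (intro sign_compose permutation_swap_id) blast+
  then show ?case
    using swap prod_inv_factor_comp[OF perm, of p] by (simp add: sign_swap_id tr o_def)
qed

text \<open>The sign \<open>- (-1) ^ (d * e)\<close> of one inversion between degrees
  \<open>d\<close> and \<open>e\<close>: permutation sign and Koszul sign together.\<close>

definition swap_sign :: "int \<Rightarrow> int \<Rightarrow> real" where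
  "swap_sign d e = (if even (d * e) then -1 else 1)"

text \<open>A permutation \<open>s\<close> of \<open>{..<k}\<close> is encoded as the word \<open>[s 0, \<dots>, s (k - 1)]\<close>.\<close>

fun chi_word :: "int list \<Rightarrow> nat list \<Rightarrow> real" where
  "chi_word ds [] = 1"
| "chi_word ds (a # w) =
     (\<Prod>b\<leftarrow>w. if b < a then swap_sign (ds ! a) (ds ! b) else 1) * chi_word ds w"

lemma chi_word_eq_prod:
  "chi_word ds w = (\<Prod>(a, b)\<in>pairs_below (length w).
     if w ! b < w ! a then swap_sign (ds ! (w ! a)) (ds ! (w ! b)) else 1)"
proof (induction w)
  case Nil
  then show ?case by (simp add: pairs_below_def)
next
  case (Cons x w)
  let ?h = "\<lambda>v (a, b). if v ! b < v ! a
     then swap_sign (ds ! (v ! a)) (ds ! (v ! b)) else 1"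
  let ?A = "(\<lambda>b. (0, Suc b)) ` {..<length w}"
    and ?B = "(\<lambda>(a, b). (Suc a, Suc b)) ` pairs_below (length w)"
  \<comment> \<open>The recursion handles the pairs that start at position 0 (\<open>?A\<close>);
    the others (\<open>?B\<close>) are the pairs of the tail with both positions shifted by
    one.\<close>
  have split: "pairs_below (length (x # w)) = ?A \<union> ?B"
  proof (intro set_eqI iffI)
    fix p assume "p \<in> pairs_below (length (x # w))"
    then obtain a b where "p = (a, Suc b)" "a \<le> b" "b < length w"
      by (cases "snd p") (auto simp: pairs_below_def)
    then show "p \<in> ?A \<union> ?B"
      by (cases a) (force simp: pairs_below_def)+
  qed (auto simp: pairs_below_def)
  have inj: "inj_on (\<lambda>(a, b). (Suc a, Suc b)) (pairs_below (length w))"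
    by (auto simp: inj_on_def)
  have "prod (?h (x # w)) (pairs_below (length (x # w)))
      = prod (?h (x # w)) ?A * prod (?h (x # w)) ?B"
    unfolding split by (rule prod.union_disjoint) auto
  also have "prod (?h (x # w)) ?B = prod (?h w) (pairs_below (length w))"
    by (subst prod.reindex[OF inj]) (auto intro!: prod.cong)
  also have "prod (?h (x # w)) ?A
      = (\<Prod>b\<leftarrow>w. if b < x then swap_sign (ds ! x) (ds ! b) else 1)"
    by (subst prod.reindex) (auto simp: inj_on_def prod.list_conv_set_nth atLeast0LessThan cong: if_cong)
  finally show ?case using Cons.IH by simp
qed

text \<open>Permutation sign and Koszul sign run over the same inversions and combine factor by
  factor into \<open>swap_sign\<close>. Signs of explicit words can then be computed by
  rewriting.\<close>

lemma chi_sign_eq_word: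
  assumes "s permutes {..<length ds}"
  shows "chi_sign s ds = chi_word ds (map s [0..<length ds])"
proof -
  let ?P = "pairs_below (length ds)"
  have "koszul_sign s ds = (\<Prod>p\<in>{p\<in>?P. s (snd p) < s (fst p)}.
        if even (ds ! s (fst p) * ds ! s (snd p)) then 1 else -1)"
    unfolding koszul_sign_def by (rule prod.cong) (auto simp: pairs_below_def)
  also have "\<dots> = (\<Prod>p\<in>?P. if s (snd p) < s (fst p)
        then (if even (ds ! s (fst p) * ds ! s (snd p)) then 1 else -1) else 1)"
    by (rule prod.inter_filter) simp
  finally have "chi_sign s ds = (\<Prod>p\<in>?P. real_of_int (inv_factor s p) * (if s (snd p) < s (fst p)
        then (if even (ds ! s (fst p) * ds ! s (snd p)) then 1 else -1) else 1))"
    by (simp add: chi_sign_def sign_eq_prod_inversions[OF assms] prod.distrib)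
  also have "\<dots> = chi_word ds (map s [0..<length ds])"
    unfolding chi_word_eq_prod
    by (rule prod.cong) (auto simp: pairs_below_def inv_factor_def swap_sign_def)
  finally show ?thesis .
qed

section \<open>Unshuffles as increasing index words\<close>

lemma sorted_wrt_subseqs:
  assumes "ys \<in> set (subseqs xs)" "sorted_wrt P xs"
  shows "sorted_wrt P ys"
  using assms
proof (induction xs arbitrary: ys)
  case (Cons x xs)
  have "set zs \<subseteq> set xs" if "zs \<in> set (subseqs xs)" for zs
    using that subseqs_powset[of xs] by blast
  with Cons show ?case by (fastforce simp: Let_def)
qed simp

text \<open>Strictly increasing lists with equal sets are equal, and \<open>subseqs\<close> reaches
  every subset. Thus the candidates for the first block of an unshuffle can be listed by
  evaluation.\<close>

lemma set_subseqs_upt: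
  "set (subseqs [0..<k]) = {I. sorted_wrt (<) I \<and> set I \<subseteq> {..<k}}"
proof (intro set_eqI iffI)
  fix I assume I: "I \<in> set (subseqs [0..<k])"
  then have "set I \<subseteq> set [0..<k]" using subseqs_powset[of "[0..<k]"] by blast
  with sorted_wrt_subseqs[OF I sorted_wrt_upt]
  show "I \<in> {I. sorted_wrt (<) I \<and> set I \<subseteq> {..<k}}" by auto
next
  fix I assume I: "I \<in> {I. sorted_wrt (<) I \<and> set I \<subseteq> {..<k}}"
  then have "set I \<in> Pow (set [0..<k])" by auto
  then obtain J where J: "J \<in> set (subseqs [0..<k])" "set J = set I"
    using subseqs_powset[of "[0..<k]"] by (metis imageE)
  have "J = I"
    using I J sorted_wrt_subseqs[OF J(1) sorted_wrt_upt] by (auto intro: strict_sorted_equal)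
  with J show "I \<in> set (subseqs [0..<k])" by simp
qed

text \<open>The last \<open>k - i\<close> values of an unshuffle are increasing and exhaust the
  complement of the first \<open>i\<close>, so there is only one way to list them.\<close>

lemma map_eq_append_complement:
  assumes "s \<in> unshuffles i k" "i \<le> k"
  shows "map s [0..<k] = map s [0..<i] @ filter (\<lambda>j. j \<notin> set (map s [0..<i])) [0..<k]"
proof -
  have perm: "s permutes {..<k}" using assms by (simp add: unshuffles_def)
  have inj: "s a = s b \<longleftrightarrow> a = b" for a b using permutes_inj[OF perm] by (auto dest: injD)
  have split: "[0..<k] = [0..<i] @ [i..<k]"
    using assms(2) by (metis le_add_diff_inverse upt_add_eq_append zero_le)
  have "sorted_wrt (<) (map s [i..<k])"
    using assms by (auto simp: unshuffles_def sorted_wrt_iff_nth_less)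
  moreover have "set (map s [i..<k]) = set (filter (\<lambda>j. j \<notin> set (map s [0..<i])) [0..<k])"
  proof -
    have "s ` {i..<k} = s ` ({..<k} - {..<i})" by (rule arg_cong[of _ _ "(`) s"]) auto
    also have "\<dots> = {..<k} - s ` {..<i}"
      unfolding image_set_diff[OF permutes_inj[OF perm]] permutes_image[OF perm] ..
    finally show ?thesis by (auto simp: atLeast0LessThan)
  qed
  ultimately have "map s [i..<k] = filter (\<lambda>j. j \<notin> set (map s [0..<i])) [0..<k]"
    by (intro strict_sorted_equal) (auto intro: sorted_wrt_filter)
  then show ?thesis unfolding split by simp
qed

lemma bij_betw_unshuffles:
  assumes "i \<le> k"
  shows "bij_betw (\<lambda>s. map s [0..<i]) (unshuffles i k)
           {I. sorted_wrt (<) I \<and> set I \<subseteq> {..<k} \<and> length I = i}" (is "bij_betw ?f ?U ?A")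
proof (rule bij_betwI')
  fix s t assume st: "s \<in> ?U" "t \<in> ?U"
  show "?f s = ?f t \<longleftrightarrow> s = t"
  proof
    assume "?f s = ?f t"
    then have "map s [0..<k] = map t [0..<k]"
      using map_eq_append_complement[OF _ assms] st by metis
    then have "s a = t a" if "a < k" for a using that by simp
    moreover have "s a = t a" if "\<not> a < k" for a
      using st that by (simp add: unshuffles_def permutes_def)
    ultimately show "s = t" by blast
  qed simp
next
  fix s assume s: "s \<in> ?U"
  then have "s a < k" if "a < i" for a
    using permutes_in_image[of s "{..<k}" a] that assms by (simp add: unshuffles_def)
  then show "?f s \<in> ?A" using s assms by (auto simp: unshuffles_def sorted_wrt_iff_nth_less)
next
  fix I assume I: "I \<in> ?A"
  define J where "J = filter (\<lambda>j. j \<notin> set I) [0..<k]"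
  \<comment> \<open>The inverse map reads off \<open>I\<close> followed by its complement and is the
    identity from \<open>k\<close> on, as \<open>permutes\<close> demands.\<close>
  define s where "s j = (if j < k then (I @ J) ! j else j)" for j
  have dist: "distinct (I @ J)" using I by (auto simp: J_def strict_sorted_iff)
  have set: "set (I @ J) = {..<k}" using I by (auto simp: J_def)
  have len: "length (I @ J) = k" using distinct_card[OF dist] set by simp
  have "bij_betw ((!) (I @ J)) {..<k} {..<k}"
    using bij_betw_nth[OF dist] len set by simp
  then have "bij_betw s {..<k} {..<k}"
    by (rule bij_betw_cong[THEN iffD1, rotated]) (simp add: s_def)
  then have "s permutes {..<k}" by (rule bij_imp_permutes) (simp add: s_def)
  moreover have "s a < s b" if "a < b" "b < i" for a b
    using that I assms by (auto simp: s_def nth_append sorted_wrt_iff_nth_less)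
  moreover have "s a < s b" if "i \<le> a" "a < b" "b < k" for a b
  proof -
    have "sorted_wrt (<) J" unfolding J_def by (intro sorted_wrt_filter) simp
    then show ?thesis using that I len by (auto simp: s_def nth_append sorted_wrt_iff_nth_less)
  qed
  ultimately have "s \<in> ?U" by (simp add: unshuffles_def)
  moreover have "I = ?f s" using I assms by (auto simp: s_def nth_append intro: nth_equalityI)
  ultimately show "\<exists>s\<in>?U. I = ?f s" by blast
qed

lemma sum_unshuffles:
  assumes "i \<le> k"
  shows "(\<Sum>s\<in>unshuffles i k. F (map s [0..<i]) (filter (\<lambda>j. j \<notin> set (map s [0..<i])) [0..<k]))
    = (\<Sum>I\<leftarrow>filter (\<lambda>I. length I = i) (subseqs [0..<k]). F I (filter (\<lambda>j. j \<notin> set I) [0..<k]))"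
proof -
  have "distinct (subseqs [0..<k])"
    using distinct_set_subseqs[of "[0..<k]"] by (simp add: distinct_map)
  then show ?thesis
    by (subst sum_list_distinct_conv_sum_set)
       (simp_all add: set_subseqs_upt conj_assoc sum.reindex_bij_betw[OF bij_betw_unshuffles[OF assms], symmetric]
         del: set_map)
qed

text \<open>Trades a sum over permutations for a sum over an explicit list of words;
  \<open>G\<close> stands for a nested bracket of the chosen and the remaining arguments.\<close>

lemma sum_unshuffles_chi:
  assumes "length xs = k" "length ds = k" "i \<le> k"
  shows "(\<Sum>s\<in>unshuffles i k. chi_sign s ds *\<^sub>R
            G (take i (perm_list s xs)) (drop i (perm_list s xs)))
    = (\<Sum>I\<leftarrow>filter (\<lambda>I. length I = i) (subseqs [0..<k]).
         let J = filter (\<lambda>j. j \<notin> set I) [0..<k]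
         in chi_word ds (I @ J) *\<^sub>R G (map ((!) xs) I) (map ((!) xs) J))"
proof -
  define F where "F I J = chi_word ds (I @ J) *\<^sub>R G (map ((!) xs) I) (map ((!) xs) J)" for I J
  have "chi_sign s ds *\<^sub>R G (take i (perm_list s xs)) (drop i (perm_list s xs))
      = F (map s [0..<i]) (filter (\<lambda>j. j \<notin> set (map s [0..<i])) [0..<k])"
    if s: "s \<in> unshuffles i k" for s
  proof -
    let ?J = "filter (\<lambda>j. j \<notin> set (map s [0..<i])) [0..<k]"
    have word: "map s [0..<k] = map s [0..<i] @ ?J"
      by (rule map_eq_append_complement[OF s assms(3)])
    have "perm_list s xs = map ((!) xs) (map s [0..<k])" by (simp add: perm_list_def assms)
    then have pl: "perm_list s xs = map ((!) xs) (map s [0..<i]) @ map ((!) xs) ?J"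
      unfolding word by (simp only: map_append)
    have "chi_sign s ds = chi_word ds (map s [0..<i] @ ?J)"
      using s chi_sign_eq_word[of s ds] unfolding word[symmetric] by (simp add: assms unshuffles_def)
    then show ?thesis unfolding pl F_def by simp
  qed
  then show ?thesis
    using sum_unshuffles[OF assms(3), of F] by (simp add: F_def Let_def del: set_map)
qed

section \<open>Expansion of the L-infinity sums for at most five arguments\<close>

lemma unshuffle_words:
  "filter (\<lambda>I. length I = Suc 0) (subseqs [0..<Suc 0]) = [[0]]"
  "filter (\<lambda>I. length I = Suc 0) (subseqs [0..<2]) = [[0], [1]]"
  "filter (\<lambda>I. length I = 2) (subseqs [0..<2]) = [[0, 1]]"
  "filter (\<lambda>I. length I = Suc 0) (subseqs [0..<3]) = [[0], [1], [2]]"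
  "filter (\<lambda>I. length I = 2) (subseqs [0..<3]) = [[0, 1], [0, 2], [1, 2]]"
  "filter (\<lambda>I. length I = 3) (subseqs [0..<3]) = [[0, 1, 2]]"
  "filter (\<lambda>I. length I = Suc 0) (subseqs [0..<4]) = [[0], [1], [2], [3]]"
  "filter (\<lambda>I. length I = 2) (subseqs [0..<4]) = [[0, 1], [0, 2], [0, 3], [1, 2], [1, 3], [2, 3]]"
  "filter (\<lambda>I. length I = 3) (subseqs [0..<4]) = [[0, 1, 2], [0, 1, 3], [0, 2, 3], [1, 2, 3]]"
  "filter (\<lambda>I. length I = 4) (subseqs [0..<4]) = [[0, 1, 2, 3]]"
  "filter (\<lambda>I. length I = 2) (subseqs [0..<5]) =
     [[0, 1], [0, 2], [0, 3], [0, 4], [1, 2], [1, 3], [1, 4], [2, 3], [2, 4], [3, 4]]"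
  "filter (\<lambda>I. length I = 3) (subseqs [0..<5]) =
     [[0, 1, 2], [0, 1, 3], [0, 1, 4], [0, 2, 3], [0, 2, 4], [0, 3, 4],
      [1, 2, 3], [1, 2, 4], [1, 3, 4], [2, 3, 4]]"
  "filter (\<lambda>I. length I = 4) (subseqs [0..<5]) =
     [[0, 1, 2, 3], [0, 1, 2, 4], [0, 1, 3, 4], [0, 2, 3, 4], [1, 2, 3, 4]]"
  by (simp_all add: upt_rec Let_def)

lemma upto_lists: "[0..<2] = [0, 1]" "[0..<3] = [0, 1, 2]" "[0..<4] = [0, 1, 2, 3]"
  "[0..<5] = [0, 1, 2, 3, 4]"
  by (simp_all add: upt_rec)

text \<open>The signs see only the parity of a degree, so parity is all that is recorded. Elements
  of degree outside -2, -1, 0 are zero and fall under the case of their parity.\<close>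

lemma hom_deg_cases:
  assumes "hom_deg d x"
  obtains a where "odd d" "x = (0, a, 0)" | e where "even d" "x = (0, 0, e)"
    | u where "even d" "x = (u, 0, 0)"
  using assms by (cases x) (fastforce simp: hom_deg_def split: if_splits)

text \<open>The inner sum of the L-infinity identity at a fixed \<open>i\<close>, without its outer
  sign, indexed by words in place of permutations.\<close>

definition jac :: "(nat \<Rightarrow> 'x list \<Rightarrow> 'x::real_vector) \<Rightarrow> int list \<Rightarrow> 'x list \<Rightarrow> nat \<Rightarrow> 'x" where
  "jac l ds xs i = (\<Sum>I\<leftarrow>filter (\<lambda>I. length I = i) (subseqs [0..<length xs]).
     let J = filter (\<lambda>j. j \<notin> set I) [0..<length xs]
     in chi_word ds (I @ J) *\<^sub>R l (length xs + 1 - i) (l i (map ((!) xs) I) # map ((!) xs) J))"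

lemma jacobi_sum_eq_jac:
  assumes "length xs = k" "length ds = k"
  shows "(\<Sum>i \<in> {1..k}. (-1::real) ^ (i * (k - i)) *\<^sub>R
           (\<Sum>s \<in> unshuffles i k. chi_sign s ds *\<^sub>R
              l (k + 1 - i) (l i (take i (perm_list s xs)) # drop i (perm_list s xs))))
       = (\<Sum>i \<in> {1..k}. (-1::real) ^ (i * (k - i)) *\<^sub>R jac l ds xs i)"
proof (rule sum.cong[OF refl])
  fix i assume "i \<in> {1..k}"
  then show "(-1::real) ^ (i * (k - i)) *\<^sub>R (\<Sum>s \<in> unshuffles i k. chi_sign s ds *\<^sub>R
              l (k + 1 - i) (l i (take i (perm_list s xs)) # drop i (perm_list s xs)))
      = (-1::real) ^ (i * (k - i)) *\<^sub>R jac l ds xs i"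
    using sum_unshuffles_chi[OF assms, of i "\<lambda>I J. l (k + 1 - i) (l i I # J)"]
    by (simp add: jac_def assms)
qed

text \<open>Stated for arbitrary \<open>l\<close> and symbolic degrees, so that the unshuffles are
  evaluated once, before any case distinction. For five arguments \<open>i = 1\<close> and
  \<open>i = 5\<close> are absent: they contain \<open>l 5\<close>, which is zero for the brackets
  in question.\<close>

lemma jac_expand:
  "jac l [d1] [x1] (Suc 0) =
     l (Suc 0) [l (Suc 0) [x1]]"
  "jac l [d1, d2] [x1, x2] (Suc 0) =
     l 2 [l (Suc 0) [x1], x2]
     + swap_sign d2 d1 *\<^sub>R l 2 [l (Suc 0) [x2], x1]"
  "jac l [d1, d2] [x1, x2] 2 =
     l (Suc 0) [l 2 [x1, x2]]"
  "jac l [d1, d2, d3] [x1, x2, x3] (Suc 0) =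
     l 3 [l (Suc 0) [x1], x2, x3]
     + swap_sign d2 d1 *\<^sub>R l 3 [l (Suc 0) [x2], x1, x3]
     + (swap_sign d3 d1 * swap_sign d3 d2) *\<^sub>R l 3 [l (Suc 0) [x3], x1, x2]"
  "jac l [d1, d2, d3] [x1, x2, x3] 2 =
     l 2 [l 2 [x1, x2], x3]
     + swap_sign d3 d2 *\<^sub>R l 2 [l 2 [x1, x3], x2]
     + (swap_sign d2 d1 * swap_sign d3 d1) *\<^sub>R l 2 [l 2 [x2, x3], x1]"
  "jac l [d1, d2, d3] [x1, x2, x3] 3 =
     l (Suc 0) [l 3 [x1, x2, x3]]"
  "jac l [d1, d2, d3, d4] [x1, x2, x3, x4] (Suc 0) =
     l 4 [l (Suc 0) [x1], x2, x3, x4]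
     + swap_sign d2 d1 *\<^sub>R l 4 [l (Suc 0) [x2], x1, x3, x4]
     + (swap_sign d3 d1 * swap_sign d3 d2) *\<^sub>R l 4 [l (Suc 0) [x3], x1, x2, x4]
     + (swap_sign d4 d1 * swap_sign d4 d2 * swap_sign d4 d3) *\<^sub>R l 4 [l (Suc 0) [x4], x1, x2, x3]"
  "jac l [d1, d2, d3, d4] [x1, x2, x3, x4] 2 =
     l 3 [l 2 [x1, x2], x3, x4]
     + swap_sign d3 d2 *\<^sub>R l 3 [l 2 [x1, x3], x2, x4]
     + (swap_sign d4 d2 * swap_sign d4 d3) *\<^sub>R l 3 [l 2 [x1, x4], x2, x3]
     + (swap_sign d2 d1 * swap_sign d3 d1) *\<^sub>R l 3 [l 2 [x2, x3], x1, x4]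
     + (swap_sign d2 d1 * swap_sign d4 d1 * swap_sign d4 d3) *\<^sub>R l 3 [l 2 [x2, x4], x1, x3]
     + (swap_sign d3 d1 * swap_sign d3 d2 * swap_sign d4 d1 * swap_sign d4 d2) *\<^sub>R l 3 [l 2 [x3, x4], x1, x2]"
  "jac l [d1, d2, d3, d4] [x1, x2, x3, x4] 3 =
     l 2 [l 3 [x1, x2, x3], x4]
     + swap_sign d4 d3 *\<^sub>R l 2 [l 3 [x1, x2, x4], x3]
     + (swap_sign d3 d2 * swap_sign d4 d2) *\<^sub>R l 2 [l 3 [x1, x3, x4], x2]
     + (swap_sign d2 d1 * swap_sign d3 d1 * swap_sign d4 d1) *\<^sub>R l 2 [l 3 [x2, x3, x4], x1]"
  "jac l [d1, d2, d3, d4] [x1, x2, x3, x4] 4 =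
     l (Suc 0) [l 4 [x1, x2, x3, x4]]"
  "jac l [d1, d2, d3, d4, d5] [x1, x2, x3, x4, x5] 2 =
     l 4 [l 2 [x1, x2], x3, x4, x5]
     + swap_sign d3 d2 *\<^sub>R l 4 [l 2 [x1, x3], x2, x4, x5]
     + (swap_sign d4 d2 * swap_sign d4 d3) *\<^sub>R l 4 [l 2 [x1, x4], x2, x3, x5]
     + (swap_sign d5 d2 * swap_sign d5 d3 * swap_sign d5 d4) *\<^sub>R l 4 [l 2 [x1, x5], x2, x3, x4]
     + (swap_sign d2 d1 * swap_sign d3 d1) *\<^sub>R l 4 [l 2 [x2, x3], x1, x4, x5]
     + (swap_sign d2 d1 * swap_sign d4 d1 * swap_sign d4 d3) *\<^sub>R l 4 [l 2 [x2, x4], x1, x3, x5]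
     + (swap_sign d2 d1 * swap_sign d5 d1 * swap_sign d5 d3 * swap_sign d5 d4) *\<^sub>R l 4 [l 2 [x2, x5], x1, x3, x4]
     + (swap_sign d3 d1 * swap_sign d3 d2 * swap_sign d4 d1 * swap_sign d4 d2) *\<^sub>R l 4 [l 2 [x3, x4], x1, x2, x5]
     + (swap_sign d3 d1 * swap_sign d3 d2 * swap_sign d5 d1 * swap_sign d5 d2 * swap_sign d5 d4) *\<^sub>R l 4 [l 2 [x3, x5], x1, x2, x4]
     + (swap_sign d4 d1 * swap_sign d4 d2 * swap_sign d4 d3 * swap_sign d5 d1 * swap_sign d5 d2 * swap_sign d5 d3) *\<^sub>R l 4 [l 2 [x4, x5], x1, x2, x3]"
  "jac l [d1, d2, d3, d4, d5] [x1, x2, x3, x4, x5] 3 =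
     l 3 [l 3 [x1, x2, x3], x4, x5]
     + swap_sign d4 d3 *\<^sub>R l 3 [l 3 [x1, x2, x4], x3, x5]
     + (swap_sign d5 d3 * swap_sign d5 d4) *\<^sub>R l 3 [l 3 [x1, x2, x5], x3, x4]
     + (swap_sign d3 d2 * swap_sign d4 d2) *\<^sub>R l 3 [l 3 [x1, x3, x4], x2, x5]
     + (swap_sign d3 d2 * swap_sign d5 d2 * swap_sign d5 d4) *\<^sub>R l 3 [l 3 [x1, x3, x5], x2, x4]
     + (swap_sign d4 d2 * swap_sign d4 d3 * swap_sign d5 d2 * swap_sign d5 d3) *\<^sub>R l 3 [l 3 [x1, x4, x5], x2, x3]
     + (swap_sign d2 d1 * swap_sign d3 d1 * swap_sign d4 d1) *\<^sub>R l 3 [l 3 [x2, x3, x4], x1, x5]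
     + (swap_sign d2 d1 * swap_sign d3 d1 * swap_sign d5 d1 * swap_sign d5 d4) *\<^sub>R l 3 [l 3 [x2, x3, x5], x1, x4]
     + (swap_sign d2 d1 * swap_sign d4 d1 * swap_sign d4 d3 * swap_sign d5 d1 * swap_sign d5 d3) *\<^sub>R l 3 [l 3 [x2, x4, x5], x1, x3]
     + (swap_sign d3 d1 * swap_sign d3 d2 * swap_sign d4 d1 * swap_sign d4 d2 * swap_sign d5 d1 * swap_sign d5 d2) *\<^sub>R l 3 [l 3 [x3, x4, x5], x1, x2]"
  "jac l [d1, d2, d3, d4, d5] [x1, x2, x3, x4, x5] 4 =
     l 2 [l 4 [x1, x2, x3, x4], x5]
     + swap_sign d5 d4 *\<^sub>R l 2 [l 4 [x1, x2, x3, x5], x4]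
     + (swap_sign d4 d3 * swap_sign d5 d3) *\<^sub>R l 2 [l 4 [x1, x2, x4, x5], x3]
     + (swap_sign d3 d2 * swap_sign d4 d2 * swap_sign d5 d2) *\<^sub>R l 2 [l 4 [x1, x3, x4, x5], x2]
     + (swap_sign d2 d1 * swap_sign d3 d1 * swap_sign d4 d1 * swap_sign d5 d1) *\<^sub>R l 2 [l 4 [x2, x3, x4, x5], x1]"
  by (simp_all add: jac_def unshuffle_words upto_lists numeral_2_eq_2[symmetric] add.assoc mult.assoc)

lemma sum_atLeast1_AtMost:
  fixes f :: "nat \<Rightarrow> 'x::comm_monoid_add"
  shows "sum f {1..1} = f (Suc 0)" "sum f {1..2} = f (Suc 0) + f 2" "sum f {1..3} = f (Suc 0) + f 2 + f 3"
    "sum f {1..4} = f (Suc 0) + f 2 + f 3 + f 4" "sum f {1..5} = f (Suc 0) + f 2 + f 3 + f 4 + f 5"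
  by (simp_all add: numeral_eq_Suc add.assoc)

lemma permutes_words:
  "s permutes {..<Suc 0} \<Longrightarrow> map s [0..<Suc 0] = [0]"
  "s permutes {..<2} \<Longrightarrow> map s [0..<2] \<in> {[0, 1], [1, 0]}"
  "s permutes {..<3} \<Longrightarrow> map s [0..<3] \<in> {[0, 1, 2], [0, 2, 1], [1, 0, 2], [1, 2, 0], [2, 0, 1], [2, 1, 0]}"
  "s permutes {..<4} \<Longrightarrow> map s [0..<4] \<in>
    {[0, 1, 2, 3], [0, 1, 3, 2], [0, 2, 1, 3], [0, 2, 3, 1], [0, 3, 1, 2], [0, 3, 2, 1],
     [1, 0, 2, 3], [1, 0, 3, 2], [1, 2, 0, 3], [1, 2, 3, 0], [1, 3, 0, 2], [1, 3, 2, 0],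
     [2, 0, 1, 3], [2, 0, 3, 1], [2, 1, 0, 3], [2, 1, 3, 0], [2, 3, 0, 1], [2, 3, 1, 0],
     [3, 0, 1, 2], [3, 0, 2, 1], [3, 1, 0, 2], [3, 1, 2, 0], [3, 2, 0, 1], [3, 2, 1, 0]}"
proof -
  assume s: "s permutes {..<Suc 0}"
  show "map s [0..<Suc 0] = [0]" using permutes_in_image[OF s, of 0] by simp
next
  assume s: "s permutes {..<2}"
  note inj = permutes_inj[OF s, THEN inj_eq]
  have "s 0 \<in> {0, 1}" "s 1 \<in> {0, 1}"
    using permutes_in_image[OF s, of 0] permutes_in_image[OF s, of 1] by auto
  moreover have "s 0 \<noteq> s 1" by (simp add: inj)
  ultimately show "map s [0..<2] \<in> {[0, 1], [1, 0]}" by (auto simp: upto_lists)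
next
  assume s: "s permutes {..<3}"
  note inj = permutes_inj[OF s, THEN inj_eq]
  have "s i \<in> {0, 1, 2}" if "i < 3" for i
    using permutes_in_image[OF s, of i] that by auto
  from this[of 0] this[of 1] this[of 2]
  have "s 0 \<in> {0, 1, 2}" "s 1 \<in> {0, 1, 2}" "s 2 \<in> {0, 1, 2}" by simp_all
  moreover have "s 0 \<noteq> s 1" "s 0 \<noteq> s 2" "s 1 \<noteq> s 2" by (simp_all add: inj)
  ultimately show "map s [0..<3] \<in> {[0, 1, 2], [0, 2, 1], [1, 0, 2], [1, 2, 0], [2, 0, 1], [2, 1, 0]}"
    unfolding upto_lists by (elim insertE emptyE) simp_all
next
  assume s: "s permutes {..<4}"
  note inj = permutes_inj[OF s, THEN inj_eq]
  have "s i \<in> {0, 1, 2, 3}" if "i < 4" for i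
    using permutes_in_image[OF s, of i] that by auto
  from this[of 0] this[of 1] this[of 2] this[of 3]
  have "s 0 \<in> {0, 1, 2, 3}" "s 1 \<in> {0, 1, 2, 3}" "s 2 \<in> {0, 1, 2, 3}" "s 3 \<in> {0, 1, 2, 3}"
    by simp_all
  moreover have "s 0 \<noteq> s 1" "s 0 \<noteq> s 2" "s 0 \<noteq> s 3" "s 1 \<noteq> s 2" "s 1 \<noteq> s 3" "s 2 \<noteq> s 3"
    by (simp_all add: inj)
  ultimately show "map s [0..<4] \<in>
    {[0, 1, 2, 3], [0, 1, 3, 2], [0, 2, 1, 3], [0, 2, 3, 1], [0, 3, 1, 2], [0, 3, 2, 1],
     [1, 0, 2, 3], [1, 0, 3, 2], [1, 2, 0, 3], [1, 2, 3, 0], [1, 3, 0, 2], [1, 3, 2, 0],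
     [2, 0, 1, 3], [2, 0, 3, 1], [2, 1, 0, 3], [2, 1, 3, 0], [2, 3, 0, 1], [2, 3, 1, 0],
     [3, 0, 1, 2], [3, 0, 2, 1], [3, 1, 0, 2], [3, 1, 2, 0], [3, 2, 0, 1], [3, 2, 1, 0]}"
    unfolding upto_lists by (elim insertE emptyE) simp_all
qed

section \<open>Calculus in an E-LWX 2-algebroid\<close>

text \<open>Reduces identities in a real vector space to linear arithmetic over the reals, which proof methods decide.\<close>

lemma eq_if_functionals_eq:
  fixes v w :: "'a::real_vector"
  assumes "\<And>f::'a \<Rightarrow> real. linear f \<Longrightarrow> f v = f w"
  shows "v = w"
proof (rule ccontr)
  assume "v \<noteq> w"
  then have "independent {v - w}" by simp
  then obtain f :: "'a \<Rightarrow> real" where f: "linear f" "f (v - w) = 1"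
    using linear_independent_extend[of "{v - w}" "\<lambda>_. 1"] by auto
  with assms[OF f(1)] show False by (simp add: linear_diff)
qed

lemmas linear_rules = linear_add linear_diff linear_neg linear_scale linear_0

text \<open>Real scalars act through \<open>of_real\<close>, so additivity and compatibility with
  the action of functions already give real linearity.\<close>

lemma linearI_of_act:
  assumes "is_module actX" "is_module actY"
    and "\<And>x y. h (x + y) = h x + h y" "\<And>f x. h (actX f x) = actY f (h x)"
  shows "linear h"
proof (rule linearI)
  fix c :: real and x
  have "h (c *\<^sub>R x) = h (actX (of_real c) x)" using assms(1) by (simp add: is_module_def)
  also have "\<dots> = c *\<^sub>R h x" using assms(2) by (simp add: assms(4) is_module_def)
  finally show "h (c *\<^sub>R x) = c *\<^sub>R h x" .
qed (rule assms(3))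

locale lwx =
  fixes actE :: "'r::{comm_ring_1,real_algebra_1} \<Rightarrow> 'u::real_vector \<Rightarrow> 'u"
    and act1 :: "'r \<Rightarrow> 'k1::real_vector \<Rightarrow> 'k1"
    and act0 :: "'r \<Rightarrow> 'k0::real_vector \<Rightarrow> 'k0"
    and pd :: "'k1 \<Rightarrow> 'k0" and rho :: "'k0 \<Rightarrow> 'u \<Rightarrow> 'u" and pS :: "'k0 \<Rightarrow> 'k1 \<Rightarrow> 'u"
    and d00 :: "'k0 \<Rightarrow> 'k0 \<Rightarrow> 'k0" and d01 :: "'k0 \<Rightarrow> 'k1 \<Rightarrow> 'k1" and d10 :: "'k1 \<Rightarrow> 'k0 \<Rightarrow> 'k1"
    and Om :: "'k0 \<Rightarrow> 'k0 \<Rightarrow> 'k0 \<Rightarrow> 'k1" and D :: "'u \<Rightarrow> 'k1"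
  assumes lwx: "E_LWX_2_algebroid actE act1 act0 pd rho pS d00 d01 d10 Om D"
begin

lemmas axioms = lwx[unfolded E_LWX_2_algebroid_def]

lemma modules: "is_module actE" "is_module act1" "is_module act0"
  by (insert axioms) (elim conjE, assumption)+

lemma leibniz: "leibniz_2_algebra pd d00 d01 d10 Om"
  by (insert axioms) (elim conjE, assumption)

lemmas leibniz_axioms = leibniz[unfolded leibniz_2_algebra_def]

lemma leibniz_rules:
  "\<forall>a b. d01 (pd a) b = d10 a (pd b)"
  "\<forall>x a. pd (d01 x a) = d00 x (pd a)"
  "\<forall>x a. pd (d10 a x) = d00 (pd a) x"
  "\<forall>x y z. pd (Om x y z) = d00 x (d00 y z) - d00 (d00 x y) z - d00 y (d00 x z)"
  "\<forall>x y a. Om x y (pd a) = d01 x (d01 y a) - d01 (d00 x y) a - d01 y (d01 x a)"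
  "\<forall>w x y z.
        d01 w (Om x y z) - d01 x (Om w y z) + d01 y (Om w x z) + d10 (Om w x y) z
      - Om (d00 w x) y z - Om x (d00 w y) z - Om x y (d00 w z)
      + Om w (d00 x y) z + Om w y (d00 x z) - Om w x (d00 y z) = 0"
  by (insert leibniz_axioms) (elim conjE, assumption)+

lemma lwx_rules:
  "\<forall>u x. pS x (D u) = rho x u"
  "\<forall>e. tot_dia d00 d01 d10 e e = (1/2) *\<^sub>R (D (tot_S pS e e), 0)"
  "\<forall>a b. pS (pd a) b = pS (pd b) a"
  "\<forall>e1 e2 e3. rho (snd e1) (tot_S pS e2 e3)
        = tot_S pS (tot_dia d00 d01 d10 e1 e2) e3 + tot_S pS e2 (tot_dia d00 d01 d10 e1 e3)"
  "\<forall>x y. rho (d00 x y) = (\<lambda>u. rho x (rho y u) - rho y (rho x u))"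
  "\<forall>x y z. Om x y z = - Om y x z" "\<forall>x y z. Om x y z = - Om x z y"
  "\<forall>x1 x2 x3 x4. pS x4 (Om x1 x2 x3) = - pS x3 (Om x1 x2 x4)"
  "\<forall>x. is_cov_diff_op actE (rho x)" "\<forall>b. (\<forall>x. pS x b = 0) \<longrightarrow> b = 0"
  by (insert axioms) (elim conjE, assumption)+

lemmas pS_D = lwx_rules(1)[rule_format]
  and E2 = lwx_rules(2)[rule_format]
  and pS_pd = lwx_rules(3)[rule_format]
  and E4 = lwx_rules(4)[rule_format]
  and Om_skew12 = lwx_rules(6)[rule_format]
  and Om_skew23 = lwx_rules(7)[rule_format]
  and pS_Om_skew = lwx_rules(8)[rule_format]

lemma rho_d00: "rho (d00 x y) u = rho x (rho y u) - rho y (rho x u)"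
  using lwx_rules(5) by simp

lemma linear_pS: "linear (pS x)" "linear (\<lambda>x. pS x b)"
proof -
  have "\<forall>x y b. pS (x + y) b = pS x b + pS y b" "\<forall>x a b. pS x (a + b) = pS x a + pS x b"
    "\<forall>f x b. pS (act0 f x) b = actE f (pS x b)" "\<forall>f x b. pS x (act1 f b) = actE f (pS x b)"
    by (insert axioms) (elim conjE, assumption)+
  with modules show "linear (pS x)" "linear (\<lambda>x. pS x b)"
    by (auto intro: linearI_of_act[of act1 actE] linearI_of_act[of act0 actE])
qed

lemma linear_rho: "linear (rho x)" "linear (\<lambda>x. rho x u)"
proof -
  have "is_cov_diff_op actE (rho x)" using lwx_rules(9) ..
  then show "linear (rho x)" by (auto simp: is_cov_diff_op_def intro: linearI)
  have "\<forall>x y u. rho (x + y) u = rho x u + rho y u" "\<forall>f x u. rho (act0 f x) u = actE f (rho x u)"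
    by (insert axioms) (elim conjE, assumption)+
  with modules show "linear (\<lambda>x. rho x u)" by (auto intro: linearI_of_act[of act0 actE])
qed

lemma pS_nondegenerate: "(\<And>x. pS x b = pS x c) \<Longrightarrow> b = c"
proof -
  assume "\<And>x. pS x b = pS x c"
  then have "\<forall>x. pS x (b - c) = 0" by (simp add: linear_diff[OF linear_pS(1)])
  with lwx_rules(10) have "b - c = 0" by blast
  then show "b = c" by simp
qed

text \<open>\<open>D\<close> is known only through its pairing with K_0; nondegeneracy transfers
  linearity from \<open>rho x\<close> to it.\<close>

lemma linear_D: "linear D"
  by (rule linearI; rule pS_nondegenerate)
     (simp_all add: pS_D linear_rules[OF linear_pS(1)] linear_rules[OF linear_rho(1)])

lemma linear_leibniz:
  "linear pd" "linear (d00 x)" "linear (\<lambda>x. d00 x y)" "linear (d01 x)" "linear (\<lambda>x. d01 x a)"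
  "linear (Om x y)" "linear (\<lambda>y. Om x y z)" "linear (\<lambda>x. Om x y z)"
proof -
  have "linear pd" "\<forall>x. linear (d00 x)" "\<forall>y. linear (\<lambda>x. d00 x y)" "\<forall>x. linear (d01 x)"
    "\<forall>a. linear (\<lambda>x. d01 x a)" "\<forall>x y. linear (Om x y)" "\<forall>x z. linear (\<lambda>y. Om x y z)"
    "\<forall>y z. linear (\<lambda>x. Om x y z)"
    by (insert leibniz_axioms) (elim conjE, assumption)+
  then show "linear pd" "linear (d00 x)" "linear (\<lambda>x. d00 x y)" "linear (d01 x)"
    "linear (\<lambda>x. d01 x a)" "linear (Om x y)" "linear (\<lambda>y. Om x y z)" "linear (\<lambda>x. Om x y z)"
    by simp_all
qed

lemmas linear_ops = linear_pS linear_rho linear_D linear_leibniz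
lemmas lin = linear_ops[THEN linear_add] linear_ops[THEN linear_diff] linear_ops[THEN linear_neg]
  linear_ops[THEN linear_scale] linear_ops[THEN linear_0]

section \<open>Elimination of \<open>d10\<close>, skewness of \<open>d00\<close>, invariance of the
  pairing\<close>

lemma d10_zero: "d10 0 x = 0" "d10 a 0 = 0"
proof -
  have "\<forall>a. linear (d10 a)" "\<forall>x. linear (\<lambda>a. d10 a x)"
    by (insert leibniz_axioms) (elim conjE, assumption)+
  then show "d10 0 x = 0" "d10 a 0 = 0" using linear_0[of "\<lambda>a. d10 a x"] linear_0[of "d10 a"] by simp_all
qed

text \<open>This is (E2) at the mixed element \<open>(a, x)\<close>, whose pairing with itself is
  twice \<open>pS x a\<close>.\<close>

lemma d10_eq: "d10 a x = D (pS x a) - d01 x a"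
  using E2[of "(a, x)"]
  by (simp add: tot_dia_def tot_S_def lin scaleR_2[symmetric] algebra_simps)

text \<open>\<open>D\<close> takes values in K_{-1}, so the K_0 component of (E2) makes
  \<open>d00\<close> alternating; polarization gives skewness.\<close>

lemma d00_skew: "d00 y x = - d00 x y"
proof -
  have alt: "d00 x x = 0" for x
    using E2[of "(0, x)"] by (simp add: tot_dia_def)
  have "d00 y x + d00 x y = 0" using alt[of "x + y"] unfolding lin by (simp add: alt add.commute)
  then show ?thesis by (simp add: eq_neg_iff_add_eq_0)
qed

lemma rho_pS: "rho x (pS y a) = pS (d00 x y) a + pS y (d01 x a)"
  using E4[of "(0, x)" "(0, y)" "(a, 0)"] by (simp add: tot_dia_def tot_S_def lin d10_zero)

lemma pd_d01: "pd (d01 x a) = d00 x (pd a)"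
  by (rule leibniz_rules(2)[rule_format])

text \<open>\<open>D (pS x a)\<close> is \<open>d10 a x + d01 x a\<close>, and the images of the two
  summands under \<open>pd\<close> cancel by skewness of \<open>d00\<close>. Surjectivity of the
  pairing extends this to all of \<Gamma>(E).\<close>

lemma pd_D: "pd (D u) = 0"
proof -
  have gen: "pd (D (pS x a)) = 0" for x a
  proof -
    have "pd (d10 a x) = d00 (pd a) x" by (rule leibniz_rules(3)[rule_format])
    then show ?thesis by (simp add: d10_eq lin pd_d01 d00_skew[of "pd a" x])
  qed
  have "\<forall>u. \<exists>ps. u = sum_list (map (\<lambda>p. pS (fst p) (snd p)) ps)"
    using axioms by (elim conjE)
  then obtain ps where "u = sum_list (map (\<lambda>p. pS (fst p) (snd p)) ps)" by blast
  moreover have "pd (D (sum_list (map (\<lambda>p. pS (fst p) (snd p)) ps))) = 0"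
    by (induction ps) (simp_all add: lin gen)
  ultimately show ?thesis by simp
qed

text \<open>By the symmetry (E3), \<open>pS (pd a) (D u)\<close> equals
  \<open>pS (pd (D u)) a\<close>, and \<open>pd \<circ> D\<close> vanishes.\<close>

lemma rho_pd: "rho (pd a) u = 0"
  using pS_pd[of a "D u"] by (simp add: pS_D pd_D lin)

text \<open>Paired with \<open>y\<close>, invariance gives
  \<open>rho x (rho y u) - rho (d00 x y) u\<close>, which (E6) turns into
  \<open>rho y (rho x u)\<close>.\<close>

lemma d01_D: "d01 x (D u) = D (rho x u)"
proof (rule pS_nondegenerate)
  fix y
  have "rho x (rho y u) = rho (d00 x y) u + pS y (d01 x (D u))"
    using rho_pS[of x y "D u"] by (simp add: pS_D)
  then show "pS y (d01 x (D u)) = pS y (D (rho x u))" by (simp add: rho_d00 pS_D)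
qed

lemma d01_pd: "d01 (pd a) b = D (pS (pd b) a) - d01 (pd b) a"
  by (rule trans[OF leibniz_rules(1)[rule_format] d10_eq])

lemma pd_Om: "pd (Om x y z) = d00 x (d00 y z) - d00 (d00 x y) z - d00 y (d00 x z)"
  and Om_pd: "Om x y (pd a) = d01 x (d01 y a) - d01 (d00 x y) a - d01 y (d01 x a)"
  by (rule leibniz_rules(4,5)[rule_format])+

lemma leibniz_Om:
  "d01 w (Om x y z) - d01 x (Om w y z) + d01 y (Om w x z) - d01 z (Om w x y) + D (pS z (Om w x y))
   = Om (d00 w x) y z + Om x (d00 w y) z + Om x y (d00 w z)
     - Om w (d00 x y) z - Om w y (d00 x z) + Om w x (d00 y z)"
  using leibniz_rules(6)[rule_format, of w x y z] by (simp add: d10_eq algebra_simps)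

section \<open>The skew brackets, the operator \<open>T\<close> and identities for three
  arguments\<close>

lemma skew00_eq: "skew00 d00 x y = d00 x y"
  by (simp add: skew00_def d00_skew[of y x] scaleR_2[symmetric])

lemma skew01_eq: "skew01 d01 d10 x a = d01 x a - (1/2) *\<^sub>R D (pS x a)"
proof (rule eq_if_functionals_eq)
  fix f :: "'k1 \<Rightarrow> real" assume f: "linear f"
  show "f (skew01 d01 d10 x a) = f (d01 x a - (1/2) *\<^sub>R D (pS x a))"
    by (simp add: skew01_def d10_eq linear_rules[OF f] field_simps)
qed

text \<open>Closed form of \<open>T_op\<close>, visibly skew in \<open>x\<close> and
  \<open>y\<close> and free of skew-symmetrized brackets.\<close>

definition T :: "'k0 \<Rightarrow> 'k0 \<Rightarrow> 'k1 \<Rightarrow> 'u" where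
  "T x y a = (1/4) *\<^sub>R (pS x (d01 y a) - pS y (d01 x a))"

text \<open>After expansion by invariance the \<open>pS (d00 x y) a\<close> terms cancel and 3/2 of
  \<open>pS x (d01 y a) - pS y (d01 x a)\<close> remains; this turns 1/6 into 1/4.\<close>

lemma T_op_eq: "T_op pS d00 d01 d10 x y a = T x y a"
proof (rule eq_if_functionals_eq)
  fix f :: "'u \<Rightarrow> real" assume f: "linear f"
  show "f (T_op pS d00 d01 d10 x y a) = f (T x y a)"
    unfolding T_op_def T_def skew00_eq skew01_eq
    by (simp only: lin linear_rules[OF f] real_scaleR_def pS_D rho_pS d00_skew[of y x]) argo
qed

lemma T_skew: "T y x a = - T x y a"
  by (simp add: T_def scaleR_diff_right)

text \<open>Third identity for two sections of K_0 and one of K_{-1}. \<open>Om_pd\<close> cancels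
  the terms free of \<open>D\<close>; the \<open>D\<close> terms that \<open>skew01\<close> adds to
  \<open>d01\<close> collect, by invariance, into \<open>D (T x y a)\<close>.\<close>

lemma jacobi_k3_K1:
  "Om x y (pd a) - D (T x y a) + skew01 d01 d10 (d00 x y) a + skew01 d01 d10 y (skew01 d01 d10 x a)
     - skew01 d01 d10 x (skew01 d01 d10 y a) = 0"
proof (rule eq_if_functionals_eq)
  fix f :: "'k1 \<Rightarrow> real" assume f: "linear f"
  show "f (Om x y (pd a) - D (T x y a) + skew01 d01 d10 (d00 x y) a + skew01 d01 d10 y (skew01 d01 d10 x a)
     - skew01 d01 d10 x (skew01 d01 d10 y a)) = f 0"
    unfolding T_def skew01_eq
    by (simp only: lin linear_rules[OF f] real_scaleR_def Om_pd pS_D rho_pS d01_D d00_skew[of y x]) argo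
qed

lemma T_D: "T x y (D u) = (1/4) *\<^sub>R rho (d00 x y) u"
  by (simp add: T_def d01_D pS_D rho_d00)

text \<open>The content of the third identity with two arguments in K_{-1}. \<open>d01_pd\<close>
  and (E3) interchange \<open>a\<close> and \<open>b\<close>, and the derivatives of
  \<open>pS (pd a) b\<close> drop out.\<close>

lemma T_pd: "T (pd a) x b = - T (pd b) x a"
proof (rule eq_if_functionals_eq)
  fix f :: "'u \<Rightarrow> real" assume f: "linear f"
  have "pS x (d01 (pd b) a) = rho x (pS (pd a) b) - pS x (d01 (pd a) b)"
    by (subst d01_pd) (simp add: lin pS_D)
  moreover have "pS (pd b) (d01 x a) = rho x (pS (pd a) b) - pS (pd a) (d01 x b)"
    by (simp add: rho_pS pS_pd[of b] pd_d01)
  ultimately have "f (pS x (d01 (pd b) a)) = f (rho x (pS (pd a) b)) - f (pS x (d01 (pd a) b))"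
    "f (pS (pd b) (d01 x a)) = f (rho x (pS (pd a) b)) - f (pS (pd a) (d01 x b))"
    by (simp_all add: linear_rules[OF f])
  then show "f (T (pd a) x b) = f (- T (pd b) x a)"
    unfolding T_def linear_rules[OF f] real_scaleR_def by argo
qed

section \<open>Skewness of \<Phi> and identities for four arguments\<close>

lemma Om_rotate: "Om x y z = Om z x y"
  by (simp add: Om_skew23[of x y z] Om_skew12[of x z y])

lemma pS_Om_rotate: "pS x (Om y z w) = - pS w (Om x y z)"
  by (simp add: pS_Om_skew[of x y z w] Om_rotate[of y z x])

text \<open>Fourth identity for sections of K_0. By skewness of \<Phi> the corrections in the four
  \<open>skew01\<close> terms add up to -2 times \<open>D (pS z (Om w x y))\<close>. One copy of
  this term stands in front as the contribution of \<open>l 4\<close>, a second comes from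
  \<open>leibniz_Om\<close>, and all cancel.\<close>

lemma jacobi_k4_K1:
  "D (pS z (Om w x y)) + Om (d00 w x) y z - Om (d00 w y) x z + Om (d00 w z) x y
    + Om (d00 x y) w z - Om (d00 x z) w y + Om (d00 y z) w x
    + skew01 d01 d10 z (Om w x y) - skew01 d01 d10 y (Om w x z)
    + skew01 d01 d10 x (Om w y z) - skew01 d01 d10 w (Om x y z) = 0"
proof (rule eq_if_functionals_eq)
  fix f :: "'k1 \<Rightarrow> real" assume f: "linear f"
  have pair: "pS y (Om w x z) = - pS z (Om w x y)" "pS x (Om w y z) = pS z (Om w x y)"
    "pS w (Om x y z) = - pS z (Om w x y)"
    by (simp_all add: pS_Om_skew[of y w x z] pS_Om_skew[of x w y z] Om_skew23[of w y x] lin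
        pS_Om_rotate[of w x y z])
  \<comment> \<open>The Leibniz identity with every inner bracket moved to the first slot of
    \<open>Om\<close>, the slot in which the L-infinity sum places it.\<close>
  have "d01 w (Om x y z) - d01 x (Om w y z) + d01 y (Om w x z) - d01 z (Om w x y) + D (pS z (Om w x y))
     = Om (d00 w x) y z - Om (d00 w y) x z + Om (d00 w z) x y
     + Om (d00 x y) w z - Om (d00 x z) w y + Om (d00 y z) w x"
    unfolding leibniz_Om Om_skew12[of _ "d00 _ _"] Om_rotate[of _ _ "d00 _ _"] by simp
  from arg_cong[OF this, of f]
  show "f (D (pS z (Om w x y)) + Om (d00 w x) y z - Om (d00 w y) x z + Om (d00 w z) x y
    + Om (d00 x y) w z - Om (d00 x z) w y + Om (d00 y z) w x
    + skew01 d01 d10 z (Om w x y) - skew01 d01 d10 y (Om w x z)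
    + skew01 d01 d10 x (Om w y z) - skew01 d01 d10 w (Om x y z)) = f 0"
    unfolding skew01_eq pair by (simp add: lin linear_rules[OF f])
qed

text \<open>Fourth identity for three sections of K_0 and one of K_{-1}. By (E3) and skewness of
  \<Phi>, all ways of inserting \<open>pd a\<close> into \<Phi> agree up to sign with
  \<open>pS (pd (Om x y z)) a\<close>. Expanding them by \<open>Om_pd\<close> and
  \<open>pd_Om\<close> yields the relations between iterated brackets that are required.\<close>

lemma jacobi_k4_U:
  "pS z (Om (pd a) x y) - T (d00 x y) z a + T (d00 x z) y a - T (d00 y z) x a
    - T y z (skew01 d01 d10 x a) + T x z (skew01 d01 d10 y a) - T x y (skew01 d01 d10 z a)
    + (1/2) *\<^sub>R (rho x (T y z a) - rho y (T x z a) + rho z (T x y a)) = 0"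
proof (rule eq_if_functionals_eq)
  fix f :: "'u \<Rightarrow> real" assume f: "linear f"
  have "pS z (Om (pd a) x y) = - pS (pd a) (Om x y z)"
    by (simp add: pS_Om_rotate[of "pd a" x y z])
  moreover have "pS x (Om y z (pd a)) = - pS (pd a) (Om x y z)"
    "pS y (Om x z (pd a)) = pS (pd a) (Om x y z)"
    "pS z (Om x y (pd a)) = - pS (pd a) (Om x y z)"
    by (simp_all add: pS_Om_rotate[of _ _ _ "pd a"] Om_skew12[of y x z] Om_rotate[of x y z, symmetric] lin)
  moreover have "pS (pd a) (Om x y z) = pS (pd (Om x y z)) a" by (rule pS_pd)
  ultimately have "f (pS z (Om (pd a) x y)) = - f (pS (pd a) (Om x y z))"
    "f (pS x (Om y z (pd a))) = - f (pS (pd a) (Om x y z))"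
    "f (pS y (Om x z (pd a))) = f (pS (pd a) (Om x y z))"
    "f (pS z (Om x y (pd a))) = - f (pS (pd a) (Om x y z))"
    "f (pS (pd a) (Om x y z)) = f (pS (pd (Om x y z)) a)"
    by (simp_all add: linear_rules[OF f])
  then show "f (pS z (Om (pd a) x y) - T (d00 x y) z a + T (d00 x z) y a - T (d00 y z) x a
    - T y z (skew01 d01 d10 x a) + T x z (skew01 d01 d10 y a) - T x y (skew01 d01 d10 z a)
    + (1/2) *\<^sub>R (rho x (T y z a) - rho y (T x z a) + rho z (T x y a))) = f 0"
    unfolding T_def skew01_eq Om_pd pd_Om
    by (simp only: lin linear_rules[OF f] real_scaleR_def pS_D rho_pS d01_D d00_skew[of y x] d00_skew[of z x] d00_skew[of z y]
       d00_skew[of "d00 _ _"] rho_d00) argo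
qed

text \<open>Instances at fixed arguments serve as rewrite rules: they express \<Phi> through the
  single value \<open>pS z (Om w x y)\<close>, whichever of the four arguments is paired.\<close>

lemma pS_Om_sort:
  "pS w (Om x y z) = - pS z (Om w x y) \<and> pS x (Om w y z) = pS z (Om w x y)
   \<and> pS y (Om w x z) = - pS z (Om w x y)"
  using pS_Om_rotate[of w x y z]
  by (simp add: pS_Om_skew[of y w x z] pS_Om_skew[of x w y z] Om_skew23[of w y x] lin)

section \<open>Closedness of \<Phi> and the identity for five arguments\<close>

lemma pS_d01_Om: "pS u (d01 v a) = rho v (pS u a) - pS (d00 v u) a"
  by (simp add: rho_pS)

lemma pS_Om_d00: "pS z (Om (d00 v w) x y) = - pS (d00 v w) (Om x y z)"
  by (simp add: pS_Om_rotate[of "d00 v w" x y z])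

text \<open>The Chevalley-Eilenberg differential of \<Phi>, formed with \<open>rho\<close> and
  \<open>d00\<close>, vanishes. Four of the derivatives come from the \<open>d01\<close> terms by
  invariance; the one along \<open>z\<close> comes from the \<open>D\<close> term of
  \<open>leibniz_Om\<close>.\<close>

lemma Om_closed:
  "rho v (pS z (Om w x y)) - rho w (pS z (Om v x y)) + rho x (pS z (Om v w y)) 
    - rho y (pS z (Om v w x)) + rho z (pS y (Om v w x))
   = - pS (d00 v w) (Om x y z) + pS (d00 v x) (Om w y z) - pS (d00 v y) (Om w x z) 
    + pS (d00 v z) (Om w x y) - pS (d00 w x) (Om v y z) + pS (d00 w y) (Om v x z) 
    - pS (d00 w z) (Om v x y) - pS (d00 x y) (Om v w z) + pS (d00 x z) (Om v w y) 
    - pS (d00 y z) (Om v w x)"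
proof -
  note sort = pS_Om_sort[of v w x y] pS_Om_sort[of v w x z] pS_Om_sort[of v w y z]
    pS_Om_sort[of v x y z] pS_Om_sort[of w x y z]
  have "d01 v (Om w x y) - d01 w (Om v x y) + d01 x (Om v w y) - d01 y (Om v w x) + D (pS y (Om v w x))
     = Om (d00 v w) x y - Om (d00 v x) w y + Om (d00 v y) w x
     + Om (d00 w x) v y - Om (d00 w y) v x + Om (d00 x y) v w"
    unfolding leibniz_Om Om_skew12[of _ "d00 _ _"] Om_rotate[of _ _ "d00 _ _"] by simp
  from arg_cong[OF this, of "pS z"] show ?thesis
    by (simp add: lin pS_D pS_d01_Om pS_Om_d00 sort algebra_simps)
qed

lemma T_Om:
  "T x y (Om u v w) = (1/4) *\<^sub>R (rho y (pS x (Om u v w)) - rho x (pS y (Om u v w))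
     + 2 *\<^sub>R pS (d00 x y) (Om u v w))"
  by (simp add: T_def pS_d01_Om d00_skew[of y x] lin scaleR_2 algebra_simps)

text \<open>Write \<open>Om_closed\<close> as R = B, with derivatives in R and brackets in B. The
  terms with \<open>Om (d00 _ _)\<close> sum to B. By \<open>T_Om\<close> each derivative occurs in
  four \<open>T\<close> terms with weight 1/4, so these give -R + B/2. The last group is -R/2, and
  the total is 3/2 (B - R).\<close>

lemma jacobi_k5_U:
  "pS z (Om (d00 v w) x y) - pS z (Om (d00 v x) w y) + pS z (Om (d00 v y) w x) 
    - pS y (Om (d00 v z) w x) + pS z (Om (d00 w x) v y) - pS z (Om (d00 w y) v x) 
    + pS y (Om (d00 w z) v x) + pS z (Om (d00 x y) v w) - pS y (Om (d00 x z) v w) 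
    + pS x (Om (d00 y z) v w)
    - T y z (Om v w x) + T x z (Om v w y) - T x y (Om v w z) 
    - T w z (Om v x y) + T w y (Om v x z) - T w x (Om v y z) 
    + T v z (Om w x y) - T v y (Om w x z) + T v x (Om w y z) 
    - T v w (Om x y z)
    + (1/2) *\<^sub>R (- rho z (pS y (Om v w x)) + rho y (pS z (Om v w x)) - rho x (pS z (Om v w y)) 
    + rho w (pS z (Om v x y)) - rho v (pS z (Om w x y))) = 0"
proof (rule eq_if_functionals_eq)
  note sort = pS_Om_sort[of v w x y] pS_Om_sort[of v w x z] pS_Om_sort[of v w y z]
    pS_Om_sort[of v x y z] pS_Om_sort[of w x y z]
  fix f :: "'u \<Rightarrow> real" assume f: "linear f"
  show "f (pS z (Om (d00 v w) x y) - pS z (Om (d00 v x) w y) + pS z (Om (d00 v y) w x) 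
    - pS y (Om (d00 v z) w x) + pS z (Om (d00 w x) v y) - pS z (Om (d00 w y) v x) 
    + pS y (Om (d00 w z) v x) + pS z (Om (d00 x y) v w) - pS y (Om (d00 x z) v w) 
    + pS x (Om (d00 y z) v w)
    - T y z (Om v w x) + T x z (Om v w y) - T x y (Om v w z) 
    - T w z (Om v x y) + T w y (Om v x z) - T w x (Om v y z) 
    + T v z (Om w x y) - T v y (Om w x z) + T v x (Om w y z) 
    - T v w (Om x y z)
    + (1/2) *\<^sub>R (- rho z (pS y (Om v w x)) + rho y (pS z (Om v w x)) - rho x (pS z (Om v w y)) 
    + rho w (pS z (Om v x y)) - rho v (pS z (Om w x y)))) = f 0"
    using arg_cong[OF Om_closed[where v=v and w=w and x=x and y=y and z=z], of f]
    by (simp only: T_Om pS_Om_d00 sort lin linear_rules[OF f] real_scaleR_def) argo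
qed

subsection \<open>The brackets and their identities\<close>

abbreviation l where "l \<equiv> lwx_bracket pd pS d00 d01 d10 Om D"
abbreviation m where "m \<equiv> skew01 d01 d10"

lemma bracket_1: "l (Suc 0) [(u, a, e)] = (0, D u, pd a)"
  by (simp add: lwx_bracket_def)

lemma bracket_2: "l 2 [(u1, a1, e1), (u2, a2, e2)]
  = ((1/2) *\<^sub>R (rho e1 u2 - rho e2 u1), m e1 a2 - m e2 a1, d00 e1 e2)"
  by (simp add: lwx_bracket_def skew00_eq pS_D scaleR_diff_right)

lemma bracket_3: "l 3 [(u1, a1, e1), (u2, a2, e2), (u3, a3, e3)]
  = (- T e1 e2 a3 + T e1 e3 a2 - T e2 e3 a1, Om e1 e2 e3, 0)"
  by (simp add: lwx_bracket_def T_op_eq)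

lemma bracket_4: "l 4 [(u1, a1, e1), (u2, a2, e2), (u3, a3, e3), (u4, a4, e4)]
  = (pS e4 (Om e1 e2 e3), 0, 0)"
  by (simp add: lwx_bracket_def)

lemmas brackets = bracket_1 bracket_2 bracket_3 bracket_4

lemma linear_T: "linear (T x y)" "linear (\<lambda>y. T x y a)" "linear (\<lambda>x. T x y a)"
  and linear_skew01: "linear (m x)" "linear (\<lambda>x. m x a)"
  by (rule linearI; simp add: T_def skew01_eq lin algebra_simps)+

lemmas linear_ops2 = linear_T linear_skew01
lemmas lin2 = lin linear_ops2[THEN linear_add] linear_ops2[THEN linear_diff]
  linear_ops2[THEN linear_neg] linear_ops2[THEN linear_scale] linear_ops2[THEN linear_0]


lemma jacobi_1: "(\<Sum>i \<in> {1..1}. (-1::real) ^ (i * (1 - i)) *\<^sub>R jac l [d1] [x1] i) = 0"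
  by (cases x1) (simp add: sum_atLeast1_AtMost jac_expand brackets lin2 pd_D zero_prod_def)

text \<open>Required by the second identity on two sections of K_{-1}, whose own bracket is
  zero.\<close>

lemma skew01_pd: "m (pd a) b = - m (pd b) a"
  by (simp add: skew01_def leibniz_rules(1)[rule_format] flip: scaleR_minus_right)

lemma pd_skew01: "pd (m x a) = d00 x (pd a)"
  by (simp add: skew01_eq lin pd_d01 pd_D)

text \<open>The correction in \<open>skew01\<close> removes half of \<open>d01 x (D u)\<close>; this
  accounts for the factor 1/2 in the bracket of K_0 with \<Gamma>(E).\<close>

lemma skew01_D: "m x (D u) = (1/2) *\<^sub>R D (rho x u)"
proof (rule eq_if_functionals_eq)
  fix f :: "'k1 \<Rightarrow> real" assume "linear f"
  note f = linear_rules[OF this]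
  show "f (m x (D u)) = f ((1/2) *\<^sub>R D (rho x u))"
    by (simp add: skew01_eq d01_D pS_D f)
qed

lemma jacobi_2:
  assumes "hom_deg d1 x1" "hom_deg d2 x2"
  shows "(\<Sum>i \<in> {1..2}. (-1::real) ^ (i * (2 - i)) *\<^sub>R jac l [d1, d2] [x1, x2] i) = 0"
  unfolding sum_atLeast1_AtMost jac_expand
  apply (rule hom_deg_cases[OF assms(1)]; rule hom_deg_cases[OF assms(2)])
  apply (simp_all add: brackets swap_sign_def lin2 zero_prod_def skew01_D pd_skew01 rho_pd
      d00_skew[of "pd _"])
  \<comment> \<open>Two arguments in K_{-1} are left.\<close>
  by (metis skew01_pd minus_minus)

lemma jacobi_3:
  assumes "hom_deg d1 x1" "hom_deg d2 x2" "hom_deg d3 x3"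
  shows "(\<Sum>i \<in> {1..3}. (-1::real) ^ (i * (3 - i)) *\<^sub>R jac l [d1, d2, d3] [x1, x2, x3] i) = 0"
proof -
  have Om: "Om (pd a) x y = D (T x y a) - m (d00 x y) a - m y (m x a) + m x (m y a)" for x y a
    using jacobi_k3_K1[of x y a] by (simp add: Om_rotate[of x y "pd a"] algebra_simps)
  have pd: "pd (Om x y z) = - d00 (d00 x y) z + d00 (d00 x z) y - d00 (d00 y z) x" for x y z
    by (simp add: pd_Om d00_skew[of "d00 x z" y] d00_skew[of "d00 y z" x])
  \<comment> \<open>The weight 1/4 of \<open>T_D\<close> is split as 1/2 - 1/4 to match the nested
    \<open>l 2\<close> terms, which carry 1/2 on \<open>rho (d00 x y)\<close> and 1/4 on iterated
    derivatives.\<close>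
  have TD: "T x y (D u) = (1/2) *\<^sub>R rho (d00 x y) u + (1/4) *\<^sub>R rho y (rho x u)
      - (1/4) *\<^sub>R rho x (rho y u)" for x y u
  proof (rule eq_if_functionals_eq)
    fix f :: "'u \<Rightarrow> real" assume "linear f"
    note f = linear_rules[OF this]
    show "f (T x y (D u)) = f ((1/2) *\<^sub>R rho (d00 x y) u + (1/4) *\<^sub>R rho y (rho x u)
      - (1/4) *\<^sub>R rho x (rho y u))"
      by (simp add: T_D rho_d00 f field_simps)
  qed
  show ?thesis
    unfolding sum_atLeast1_AtMost jac_expand
    apply (rule hom_deg_cases[OF assms(1)]; rule hom_deg_cases[OF assms(2)]; rule hom_deg_cases[OF assms(3)])
    apply (simp_all add: brackets swap_sign_def lin2 zero_prod_def Om pd TD scaleR_diff_right)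
    \<comment> \<open>Two arguments in K_{-1} and one in K_0 are left, in any order.\<close>
    by (metis T_pd add.left_inverse minus_minus)+
qed

lemma jacobi_4:
  assumes "hom_deg d1 x1" "hom_deg d2 x2" "hom_deg d3 x3" "hom_deg d4 x4"
  shows "(\<Sum>i \<in> {1..4}. (-1::real) ^ (i * (4 - i)) *\<^sub>R jac l [d1, d2, d3, d4] [x1, x2, x3, x4] i) = 0"
proof -
  \<comment> \<open>\<open>K1\<close> and \<open>U\<close> are the two identities solved for the
    values of \<open>l 1\<close> after \<open>l 4\<close> and of \<open>l 4\<close> after
    \<open>l 1\<close>, so that rewriting eliminates these.\<close>
  have K1: "D (pS z (Om w x y)) = - Om (d00 w x) y z + Om (d00 w y) x z - Om (d00 w z) x y
      - Om (d00 x y) w z + Om (d00 x z) w y - Om (d00 y z) w x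
      - m z (Om w x y) + m y (Om w x z) - m x (Om w y z) + m w (Om x y z)" for w x y z
    using jacobi_k4_K1[of z w x y] by (simp add: algebra_simps)
  have U: "pS z (Om (pd a) x y) = T (d00 x y) z a - T (d00 x z) y a + T (d00 y z) x a
      + T y z (m x a) - T x z (m y a) + T x y (m z a)
      - (1/2) *\<^sub>R rho x (T y z a) + (1/2) *\<^sub>R rho y (T x z a) - (1/2) *\<^sub>R rho z (T x y a)" for x y z a
    using jacobi_k4_U[of z a x y] by (simp add: algebra_simps)
  show ?thesis
    unfolding sum_atLeast1_AtMost jac_expand
    by (rule hom_deg_cases[OF assms(1)]; rule hom_deg_cases[OF assms(2)]; rule hom_deg_cases[OF assms(3)];
        rule hom_deg_cases[OF assms(4)];
        simp add: brackets swap_sign_def lin2 zero_prod_def; simp add: K1 U)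
qed

text \<open>For \<open>l 4\<close> and for the fifth identity only arguments with nonzero K_0
  component count; two cases per argument keep the number of combinations small.\<close>

lemma hom_deg_cases_snd:
  fixes x :: "'u \<times> 'k1 \<times> 'k0"
  assumes "hom_deg d x"
  obtains e where "d = 0" "x = (0, 0, e)" | u a where "x = (u, a, 0)"
  using assms by (cases x) (fastforce simp: hom_deg_def split: if_splits)

lemma bracket_5: "l 5 xs = 0"
  by (simp add: lwx_bracket_def)

lemma jac_5_trivial: "length xs = 5 \<Longrightarrow> jac l ds xs (Suc 0) = 0" "length xs = 5 \<Longrightarrow> jac l ds xs 5 = 0"
proof -
  show "jac l ds xs (Suc 0) = 0" if "length xs = 5"
    unfolding jac_def using that by (simp add: bracket_5 Let_def)
  have "l (Suc 0) [0] = 0" by (simp add: zero_prod_def bracket_1 lin)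
  moreover have "filter (\<lambda>I. length I = 5) (subseqs [0..<5]) = [[0, 1, 2, 3, 4]]"
    by (simp add: upt_rec Let_def)
  ultimately show "jac l ds xs 5 = 0" if "length xs = 5"
    unfolding jac_def using that by (simp add: bracket_5 upto_lists)
qed

lemma jacobi_5:
  assumes "hom_deg d1 x1" "hom_deg d2 x2" "hom_deg d3 x3" "hom_deg d4 x4" "hom_deg d5 x5"
  shows "(\<Sum>i \<in> {1..5}. (-1::real) ^ (i * (5 - i)) *\<^sub>R jac l [d1, d2, d3, d4, d5] [x1, x2, x3, x4, x5] i) = 0"
  unfolding sum_atLeast1_AtMost jac_expand
  apply (rule hom_deg_cases_snd[OF assms(1)]; rule hom_deg_cases_snd[OF assms(2)];
      rule hom_deg_cases_snd[OF assms(3)]; rule hom_deg_cases_snd[OF assms(4)];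
      rule hom_deg_cases_snd[OF assms(5)])
  apply (simp_all add: brackets jac_expand jac_5_trivial swap_sign_def lin2 zero_prod_def)
  subgoal for e1 e2 e3 e4 e5
    using jacobi_k5_U[where v = e1 and w = e2 and x = e3 and y = e4 and z = e5]
    by (simp add: algebra_simps)
  done

lemma bracket_zero_arg:
  assumes "0 \<in> set xs"
  shows "l n xs = 0"
proof -
  obtain p where p: "p < length xs" "xs ! p = 0" using assms by (metis in_set_conv_nth)
  then show ?thesis
    by (auto simp: lwx_bracket_def Let_def T_op_eq skew00_eq lin2 numeral_eq_Suc less_Suc_eq zero_prod_def)
qed

text \<open>Values of \<open>l 3\<close> have no K_0 component, which \<open>l 4\<close> demands in
  every slot; values of \<open>l 4\<close> lie in \<Gamma>(E), which \<open>l 3\<close> and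
  \<open>l 4\<close> ignore. Brackets of higher arity are zero.\<close>

lemma bracket_bracket_zero:
  assumes "7 \<le> i + j"
  shows "l j (l i ys # zs) = 0"
proof (cases "i \<le> 4 \<and> j \<le> 4")
  case True
  with assms consider "i = 3" "j = 4" | "i = 4" "j = 3" | "i = 4" "j = 4" by linarith
  then show ?thesis
    by cases (auto simp: lwx_bracket_def Let_def T_op_eq skew00_eq lin2 zero_prod_def)
next
  case False
  then have "l i ys = 0 \<or> l j (l i ys # zs) = 0" by (auto simp: lwx_bracket_def)
  then show ?thesis by (auto intro: bracket_zero_arg)
qed

lemma jacobi_ge_6:
  assumes "6 \<le> k" "length xs = k" 
  shows "(\<Sum>i \<in> {1..k}. (-1::real) ^ (i * (k - i)) *\<^sub>R jac l ds xs i) = 0"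
proof (rule sum.neutral, rule ballI)
  fix i assume "i \<in> {1..k}"
  then have "7 \<le> i + (k + 1 - i)" using assms by simp
  then show "(-1::real) ^ (i * (k - i)) *\<^sub>R jac l ds xs i = 0"
    unfolding jac_def by (simp add: assms bracket_bracket_zero Let_def)
qed

lemma jacobi:
  assumes "1 \<le> k" "length xs = k" "homogeneous_list ds xs"
  shows "(\<Sum>i \<in> {1..k}. (-1::real) ^ (i * (k - i)) *\<^sub>R jac l ds xs i) = 0"
proof (cases "k \<le> 5")
  case True
  have len: "length ds = length xs" and hom: "\<And>i. i < length xs \<Longrightarrow> hom_deg (ds ! i) (xs ! i)"
    using assms(3) by (auto simp: homogeneous_list_def)
  from True assms(1) consider "k = Suc 0" | "k = 2" | "k = 3" | "k = 4" | "k = 5" by linarith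
  then show ?thesis
  proof cases
    case 1
    then obtain x1 d1 where "xs = [x1]" "ds = [d1]"
      using assms(2) len by (auto simp: length_Suc_conv)
    then show ?thesis using jacobi_1[of d1 x1] 1 by simp
  next
    case 2
    then obtain x1 x2 d1 d2 where "xs = [x1, x2]" "ds = [d1, d2]"
      using assms(2) len by (auto simp: length_Suc_conv numeral_eq_Suc)
    then show ?thesis using jacobi_2[of d1 x1 d2 x2] 2 hom[of 0] hom[of 1] by simp
  next
    case 3
    then obtain x1 x2 x3 d1 d2 d3 where "xs = [x1, x2, x3]" "ds = [d1, d2, d3]"
      using assms(2) len by (auto simp: length_Suc_conv numeral_eq_Suc)
    then show ?thesis using jacobi_3[of d1 x1 d2 x2 d3 x3] 3 hom[of 0] hom[of 1] hom[of 2] by simp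
  next
    case 4
    then obtain x1 x2 x3 x4 d1 d2 d3 d4 where "xs = [x1, x2, x3, x4]" "ds = [d1, d2, d3, d4]"
      using assms(2) len by (auto simp: length_Suc_conv numeral_eq_Suc)
    then show ?thesis
      using jacobi_4[of d1 x1 d2 x2 d3 x3 d4 x4] 4 hom[of 0] hom[of 1] hom[of 2] hom[of 3] by simp
  next
    case 5
    then obtain x1 x2 x3 x4 x5 d1 d2 d3 d4 d5
      where "xs = [x1, x2, x3, x4, x5]" "ds = [d1, d2, d3, d4, d5]"
      using assms(2) len by (auto simp: length_Suc_conv numeral_eq_Suc)
    then show ?thesis
      using jacobi_5[of d1 x1 d2 x2 d3 x3 d4 x4 d5 x5] 5
        hom[of 0] hom[of 1] hom[of 2] hom[of 3] hom[of 4] by simp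
  qed
qed (use jacobi_ge_6 assms in simp)

subsection \<open>Multilinearity, degrees and graded skew-symmetry\<close>

lemma bracket_multilinear:
  assumes "n \<in> {1..4}" "length xs = n" "p < n"
  shows "l n (xs[p := c *\<^sub>R x + y]) = c *\<^sub>R l n (xs[p := x]) + l n (xs[p := y])"
proof -
  obtain u a e u' a' e' where xy: "x = (u, a, e)" "y = (u', a', e')" by (cases x; cases y)
  from assms(1) consider "n = Suc 0" | "n = 2" | "n = 3" | "n = 4" by fastforce
  then show ?thesis
  proof cases
    case 1
    then obtain x1 where "xs = [x1]" using assms(2) by (auto simp: length_Suc_conv)
    with 1 assms(3) show ?thesis by (simp add: xy brackets lin2)
  next
    case 2
    then obtain u1 a1 e1 u2 a2 e2 where "xs = [(u1, a1, e1), (u2, a2, e2)]"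
      using assms(2) by (auto simp: length_Suc_conv numeral_eq_Suc)
    moreover have "p \<in> {0, 1}" using 2 assms(3) by auto
    ultimately show ?thesis using 2 by (auto simp: xy brackets lin2 algebra_simps)
  next
    case 3
    then obtain u1 a1 e1 u2 a2 e2 u3 a3 e3 where "xs = [(u1, a1, e1), (u2, a2, e2), (u3, a3, e3)]"
      using assms(2) by (auto simp: length_Suc_conv numeral_eq_Suc)
    moreover have "p \<in> {0, 1, 2}" using 3 assms(3) by auto
    ultimately show ?thesis using 3 by (auto simp: xy brackets lin2 algebra_simps)
  next
    case 4
    then obtain u1 a1 e1 u2 a2 e2 u3 a3 e3 u4 a4 e4
      where "xs = [(u1, a1, e1), (u2, a2, e2), (u3, a3, e3), (u4, a4, e4)]"
      using assms(2) by (auto simp: length_Suc_conv numeral_eq_Suc)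
    moreover have "p \<in> {0, 1, 2, 3}" using 4 assms(3) by auto
    ultimately show ?thesis using 4 by (auto simp: xy brackets lin2 algebra_simps)
  qed
qed

text \<open>Counting degrees needs the exact degree of each argument; zero is homogeneous of every
  degree and forms a case of its own.\<close>

lemma hom_deg_cases_degree:
  fixes x :: "'u \<times> 'k1 \<times> 'k0"
  assumes "hom_deg d x"
  obtains e where "d = 0" "x = (0, 0, e)" | a where "d = -1" "x = (0, a, 0)"
    | u where "d = -2" "x = (u, 0, 0)" | "x = (0, 0, 0)"
  using assms by (cases x) (fastforce simp: hom_deg_def split: if_splits)

lemma hom_deg_0: "hom_deg d (0, 0, 0)"
  by (simp add: hom_deg_def)

lemma bracket_degree:
  assumes "n \<in> {1..4}" "length xs = n" "homogeneous_list ds xs"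
  shows "hom_deg (sum_list ds + 2 - int n) (l n xs)"
proof -
  have len: "length ds = length xs" and hom: "\<And>i. i < length xs \<Longrightarrow> hom_deg (ds ! i) (xs ! i)"
    using assms(3) by (auto simp: homogeneous_list_def)
  from assms(1) consider "n = Suc 0" | "n = 2" | "n = 3" | "n = 4" by fastforce
  then show ?thesis
  proof cases
    case 1
    then obtain x1 d1 where x: "xs = [x1]" "ds = [d1]"
      using assms(2) len by (auto simp: length_Suc_conv)
    then have "hom_deg d1 x1" using hom[of 0] by simp
    then show ?thesis
      unfolding x 1 by (rule hom_deg_cases_degree) (simp_all add: brackets lin2 hom_deg_def)
  next
    case 2
    then obtain x1 x2 d1 d2 where x: "xs = [x1, x2]" "ds = [d1, d2]"
      using assms(2) len by (auto simp: length_Suc_conv numeral_eq_Suc)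
    then have h: "hom_deg d1 x1" "hom_deg d2 x2" using hom[of 0] hom[of 1] by simp_all
    show ?thesis
      unfolding x 2 by (rule hom_deg_cases_degree[OF h(1)]; rule hom_deg_cases_degree[OF h(2)])
        (simp_all add: brackets lin2 hom_deg_0, simp_all add: hom_deg_def)
  next
    case 3
    then obtain x1 x2 x3 d1 d2 d3 where x: "xs = [x1, x2, x3]" "ds = [d1, d2, d3]"
      using assms(2) len by (auto simp: length_Suc_conv numeral_eq_Suc)
    then have h: "hom_deg d1 x1" "hom_deg d2 x2" "hom_deg d3 x3"
      using hom[of 0] hom[of 1] hom[of 2] by simp_all
    show ?thesis
      unfolding x 3 by (rule hom_deg_cases_degree[OF h(1)]; rule hom_deg_cases_degree[OF h(2)];
          rule hom_deg_cases_degree[OF h(3)])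
        (simp_all add: brackets lin2 hom_deg_0, simp_all add: hom_deg_def)
  next
    case 4
    then obtain x1 x2 x3 x4 d1 d2 d3 d4 where x: "xs = [x1, x2, x3, x4]" "ds = [d1, d2, d3, d4]"
      using assms(2) len by (auto simp: length_Suc_conv numeral_eq_Suc)
    then have h: "hom_deg d1 x1" "hom_deg d2 x2" "hom_deg d3 x3" "hom_deg d4 x4"
      using hom[of 0] hom[of 1] hom[of 2] hom[of 3] by simp_all
    show ?thesis
      unfolding x 4 by (rule hom_deg_cases_snd[OF h(1)]; rule hom_deg_cases_snd[OF h(2)];
          rule hom_deg_cases_snd[OF h(3)]; rule hom_deg_cases_snd[OF h(4)])
        (simp_all add: brackets lin2 hom_deg_0, simp_all add: hom_deg_def)
  qed
qed

section \<open>Graded skew-symmetry, permutation by permutation\<close>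

lemma Om_sort: "Om x z y = - Om x y z \<and> Om y x z = - Om x y z \<and> Om y z x = Om x y z
  \<and> Om z x y = Om x y z \<and> Om z y x = - Om x y z"
  using Om_skew23[of x z y] Om_skew12[of y x z] Om_rotate[of y z x] Om_rotate[of x y z]
    Om_skew12[of z y x] by simp

lemma hom_deg_cases_parity:
  fixes x :: "'u \<times> 'k1 \<times> 'k0"
  assumes "hom_deg d x"
  obtains u a e where "x = (u, a, e)" "odd d \<and> u = 0 \<and> e = 0 \<or> even d \<and> a = 0"
  using assms by (rule hom_deg_cases) auto

lemma bracket_word_2:
  assumes "hom_deg d1 x1" "hom_deg d2 x2" "w \<in> {[0, 1], [1, 0]}"
  shows "l 2 (map ((!) [x1, x2]) w) = chi_word [d1, d2] w *\<^sub>R l 2 [x1, x2]"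
proof -
  obtain u1 a1 e1 where 1: "x1 = (u1, a1, e1)" "odd d1 \<and> u1 = 0 \<and> e1 = 0 \<or> even d1 \<and> a1 = 0"
    using assms(1) by (rule hom_deg_cases_parity)
  obtain u2 a2 e2 where 2: "x2 = (u2, a2, e2)" "odd d2 \<and> u2 = 0 \<and> e2 = 0 \<or> even d2 \<and> a2 = 0"
    using assms(2) by (rule hom_deg_cases_parity)
  show ?thesis
    using 1(2) 2(2) assms(3) unfolding 1(1) 2(1)
    by (elim disjE insertE emptyE;
        simp add: brackets swap_sign_def lin2 d00_skew[of e2 e1] flip: scaleR_minus_right)
qed

lemma bracket_word_3:
  assumes "hom_deg d1 x1" "hom_deg d2 x2" "hom_deg d3 x3" "w \<in> {[0, 1, 2], [0, 2, 1], [1, 0, 2], [1, 2, 0], [2, 0, 1], [2, 1, 0]}"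
  shows "l 3 (map ((!) [x1, x2, x3]) w) = chi_word [d1, d2, d3] w *\<^sub>R l 3 [x1, x2, x3]"
proof -
  obtain u1 a1 e1 where 1: "x1 = (u1, a1, e1)" "odd d1 \<and> u1 = 0 \<and> e1 = 0 \<or> even d1 \<and> a1 = 0"
    using assms(1) by (rule hom_deg_cases_parity)
  obtain u2 a2 e2 where 2: "x2 = (u2, a2, e2)" "odd d2 \<and> u2 = 0 \<and> e2 = 0 \<or> even d2 \<and> a2 = 0"
    using assms(2) by (rule hom_deg_cases_parity)
  obtain u3 a3 e3 where 3: "x3 = (u3, a3, e3)" "odd d3 \<and> u3 = 0 \<and> e3 = 0 \<or> even d3 \<and> a3 = 0"
    using assms(3) by (rule hom_deg_cases_parity)
  show ?thesis
    using 1(2) 2(2) 3(2) assms(4) unfolding 1(1) 2(1) 3(1)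
    by (elim disjE insertE emptyE;
        simp add: brackets swap_sign_def lin2 T_skew[of e2 e1] T_skew[of e3 e1] T_skew[of e3 e2]
          Om_sort[where x = e1 and y = e2 and z = e3])
qed

text \<open>If some K_0 component is zero, both sides vanish whatever the sign. Otherwise all
  degrees are 0, the sign is that of the permutation, and skewness of \<Phi> applies.\<close>

lemma bracket_word_4:
  assumes "hom_deg d1 x1" "hom_deg d2 x2" "hom_deg d3 x3" "hom_deg d4 x4" "w \<in>
    {[0, 1, 2, 3], [0, 1, 3, 2], [0, 2, 1, 3], [0, 2, 3, 1], [0, 3, 1, 2], [0, 3, 2, 1],
     [1, 0, 2, 3], [1, 0, 3, 2], [1, 2, 0, 3], [1, 2, 3, 0], [1, 3, 0, 2], [1, 3, 2, 0],
     [2, 0, 1, 3], [2, 0, 3, 1], [2, 1, 0, 3], [2, 1, 3, 0], [2, 3, 0, 1], [2, 3, 1, 0],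
     [3, 0, 1, 2], [3, 0, 2, 1], [3, 1, 0, 2], [3, 1, 2, 0], [3, 2, 0, 1], [3, 2, 1, 0]}"
  shows "l 4 (map ((!) [x1, x2, x3, x4]) w) = chi_word [d1, d2, d3, d4] w *\<^sub>R l 4 [x1, x2, x3, x4]"
proof (cases "snd (snd x1) = 0 \<or> snd (snd x2) = 0 \<or> snd (snd x3) = 0 \<or> snd (snd x4) = 0")
  case True
  obtain u1 a1 e1 u2 a2 e2 u3 a3 e3 u4 a4 e4
    where x: "x1 = (u1, a1, e1)" "x2 = (u2, a2, e2)" "x3 = (u3, a3, e3)" "x4 = (u4, a4, e4)"
    by (metis surj_pair)
  show ?thesis
    using True assms(5) unfolding x by (elim disjE insertE emptyE; simp add: brackets lin2)
next
  case False
  then have "d1 = 0" "d2 = 0" "d3 = 0" "d4 = 0"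
    using assms(1-4) by (auto elim!: hom_deg_cases_snd)
  moreover obtain u1 a1 e1 u2 a2 e2 u3 a3 e3 u4 a4 e4
    where x: "x1 = (u1, a1, e1)" "x2 = (u2, a2, e2)" "x3 = (u3, a3, e3)" "x4 = (u4, a4, e4)"
    by (metis surj_pair)
  ultimately show ?thesis
    using assms(5) unfolding x
    by (elim insertE emptyE;
        simp add: brackets swap_sign_def lin2 Om_sort[where x = e1 and y = e2 and z = e3] Om_sort[where x = e1 and y = e2 and z = e4]
          Om_sort[where x = e1 and y = e3 and z = e4] Om_sort[where x = e2 and y = e3 and z = e4] pS_Om_sort[of e1 e2 e3 e4])
qed

lemma bracket_graded_skew:
  assumes "n \<in> {1..4}" "length xs = n" "homogeneous_list ds xs" "s permutes {..<n}"
  shows "l n (perm_list s xs) = chi_sign s ds *\<^sub>R l n xs"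
proof -
  have len: "length ds = length xs" and hom: "\<And>i. i < length xs \<Longrightarrow> hom_deg (ds ! i) (xs ! i)"
    using assms(3) by (auto simp: homogeneous_list_def)
  have perm: "perm_list s xs = map ((!) xs) (map s [0..<n])"
    and chi: "chi_sign s ds = chi_word ds (map s [0..<n])"
    using assms chi_sign_eq_word[of s ds] len by (simp_all add: perm_list_def)
  from assms(1) consider "n = Suc 0" | "n = 2" | "n = 3" | "n = 4" by fastforce
  then show ?thesis
  proof cases
    case 1
    then obtain x1 d1 where x: "xs = [x1]" "ds = [d1]"
      using assms(2) len by (auto simp: length_Suc_conv)
    have "map s [0..<n] = [0]" unfolding 1 using permutes_words(1) assms(4) 1 by blast
    then show ?thesis unfolding perm chi by (simp add: x)
  next
    case 2
    then obtain x1 x2 d1 d2 where x: "xs = [x1, x2]" "ds = [d1, d2]"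
      using assms(2) len by (auto simp: length_Suc_conv numeral_eq_Suc)
    then have h: "hom_deg d1 x1" "hom_deg d2 x2" using hom[of 0] hom[of 1] by simp_all
    show ?thesis
      unfolding perm chi unfolding x 2 by (rule bracket_word_2[OF h permutes_words(2)]) (use assms(4) 2 in simp)
  next
    case 3
    then obtain x1 x2 x3 d1 d2 d3 where x: "xs = [x1, x2, x3]" "ds = [d1, d2, d3]"
      using assms(2) len by (auto simp: length_Suc_conv numeral_eq_Suc)
    then have h: "hom_deg d1 x1" "hom_deg d2 x2" "hom_deg d3 x3"
      using hom[of 0] hom[of 1] hom[of 2] by simp_all
    show ?thesis
      unfolding perm chi unfolding x 3 by (rule bracket_word_3[OF h permutes_words(3)]) (use assms(4) 3 in simp)
  next
    case 4
    then obtain x1 x2 x3 x4 d1 d2 d3 d4 where x: "xs = [x1, x2, x3, x4]" "ds = [d1, d2, d3, d4]"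
      using assms(2) len by (auto simp: length_Suc_conv numeral_eq_Suc)
    then have h: "hom_deg d1 x1" "hom_deg d2 x2" "hom_deg d3 x3" "hom_deg d4 x4"
      using hom[of 0] hom[of 1] hom[of 2] hom[of 3] by simp_all
    show ?thesis
      unfolding perm chi unfolding x 4 by (rule bracket_word_4[OF h permutes_words(4)]) (use assms(4) 4 in simp)
  qed
qed

theorem lie3_algebra_bracket: "lie3_algebra l"
  unfolding lie3_algebra_def
proof (intro conjI allI ballI impI; (elim conjE)?)
  fix n :: nat and xs :: "('u \<times> 'k1 \<times> 'k0) list"
  assume "n = 0 \<or> 4 < n"
  then show "l n xs = 0" by (auto simp: lwx_bracket_def)
next
  fix k and xs :: "('u \<times> 'k1 \<times> 'k0) list" and ds
  assume k: "1 \<le> k" "length xs = k" "homogeneous_list ds xs"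
  then have "length ds = k" by (simp add: homogeneous_list_def)
  from jacobi_sum_eq_jac[OF k(2) this, of l] jacobi[OF k]
  show "(\<Sum>i \<in> {1..k}. (-1::real) ^ (i * (k - i)) *\<^sub>R
     (\<Sum>s \<in> unshuffles i k. chi_sign s ds *\<^sub>R
        l (k + 1 - i) (l i (take i (perm_list s xs)) # drop i (perm_list s xs)))) = 0" by simp
qed (simp_all only: bracket_multilinear bracket_degree bracket_graded_skew)

end

theorem theorem6p2:
  fixes actE :: "'r::{comm_ring_1,real_algebra_1} \<Rightarrow> 'u::real_vector \<Rightarrow> 'u"
    and act1 :: "'r \<Rightarrow> 'k1::real_vector \<Rightarrow> 'k1"
    and act0 :: "'r \<Rightarrow> 'k0::real_vector \<Rightarrow> 'k0"
    and pd :: "'k1 \<Rightarrow> 'k0" and rho :: "'k0 \<Rightarrow> 'u \<Rightarrow> 'u" and pS :: "'k0 \<Rightarrow> 'k1 \<Rightarrow> 'u"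
    and d00 :: "'k0 \<Rightarrow> 'k0 \<Rightarrow> 'k0" and d01 :: "'k0 \<Rightarrow> 'k1 \<Rightarrow> 'k1" and d10 :: "'k1 \<Rightarrow> 'k0 \<Rightarrow> 'k1"
    and Om :: "'k0 \<Rightarrow> 'k0 \<Rightarrow> 'k0 \<Rightarrow> 'k1" and D :: "'u \<Rightarrow> 'k1"
  assumes "E_LWX_2_algebroid actE act1 act0 pd rho pS d00 d01 d10 Om D"
  shows "lie3_algebra (lwx_bracket pd pS d00 d01 d10 Om D)"
  by (rule lwx.lie3_algebra_bracket[OF lwx.intro[OF assms]])

end
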